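(* Let $q$ be a positive integer. Then $q \in \mathbb{Z}_A(\mathcal{L})$ if and only if $$ Z_\mathcal{L}^P(q,\mathbf{v})= q^{\mathrm{rk}(G)} Z_{\mathcal{A}_\mathcal{L}}(q,\mathbf{v}), $$ as a polynomial in $\mathbf{v}$. In particular, if $q$ is a multiple of the least common multiple of the multiplicities $m(B)$ over all bases $B\subseteq E$, then this equality holds.
   Context: Let $\mathcal{L}=(g_e)_{e \in E}$ be a finite list of elements of a finitely generated abelian group $G$. For $A\subseteq E$, let $\mathcal{L}_A=(g_e)_{e\in A}$, let $\mathrm{rk}(A)$ be the rank of $\langle\mathcal{L}_A\rangle$, let $G_A$ be the torsion subgroup of $G/\langle \mathcal{L}_A\rangle$ and $m(A):=|G_A|$; $\mathcal{A}_\mathcal{L}$ is the arithmetic matroid on $E$ with these rank and multiplicity functions, and $Z_{\mathcal{A}_\mathcal{L}}(q,\mathbf{v}) = \sum_{A \subseteq E} m(A) q^{-\mathrm{rk}(A)} \prod_{e \in A}v_e$. Define $Z_\mathcal{L}^P(q,\mathbf{v}) := \sum_{\phi \in \mathrm{Hom}(G, \mathbb{Z}/q\mathbb{Z})} \prod_{e \in E}(1+v_{e}\delta(\phi(g_e),0))$, with $\delta$ the Kronecker delta. Let $\mathbb{Z}_A(\mathcal{L}) := \{q \in \mathbb{Z}_{>0} : qG_B=(0) \text{ for all bases } B \subseteq E\}$. *)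

theory Defs
  imports "HOL-Algebra.Algebra" "HOL-Library.Poly_Mapping"
begin

(* Abelian groups are the commutative groups of HOL-Algebra, hence written multiplicatively:
   n x becomes x [^] n, and 0 becomes \<one>. *)

definition finitely_generated :: "('a, 'b) monoid_scheme \<Rightarrow> bool" where
  "finitely_generated G \<longleftrightarrow>
     (\<exists>S. finite S \<and> S \<subseteq> carrier G \<and> generate G S = carrier G)"

definition int_independent :: "('a, 'b) monoid_scheme \<Rightarrow> 'a set \<Rightarrow> bool" where
  "int_independent G S \<longleftrightarrow> finite S \<and> S \<subseteq> carrier G \<and>
     (\<forall>c :: 'a \<Rightarrow> int. (\<Otimes>\<^bsub>G\<^esub>s\<in>S. s [^]\<^bsub>G\<^esub> c s) = \<one>\<^bsub>G\<^esub> \<longrightarrow> (\<forall>s\<in>S. c s = 0))"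

(* The cardinalities are bounded when G is finitely generated, so this supremum is a maximum. *)
definition abelian_rank :: "('a, 'b) monoid_scheme \<Rightarrow> nat" where
  "abelian_rank G = Sup {card S | S. int_independent G S}"

definition torsion_elements :: "('a, 'b) monoid_scheme \<Rightarrow> 'a set" where
  "torsion_elements G = {x \<in> carrier G. \<exists>n::nat. n > 0 \<and> x [^]\<^bsub>G\<^esub> n = \<one>\<^bsub>G\<^esub>}"

(* Hom(G, H) as a set of homomorphisms: the library's hom leaves the values outside the
   carrier unconstrained, so a homomorphism would be represented by many functions. *)
definition Hom :: "('a, 'b) monoid_scheme \<Rightarrow> ('c, 'd) monoid_scheme \<Rightarrow> ('a \<Rightarrow> 'c) set" where
  "Hom G H = hom G H \<inter> extensional (carrier G)"


(* A list (g_e)_{e \<in> E} in G is a function g on the index set E. *)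

definition quot :: "('a, 'b) monoid_scheme \<Rightarrow> ('e \<Rightarrow> 'a) \<Rightarrow> 'e set \<Rightarrow> 'a set monoid" where
  "quot G g A = G Mod generate G (g ` A)"

definition list_rank :: "('a, 'b) monoid_scheme \<Rightarrow> ('e \<Rightarrow> 'a) \<Rightarrow> 'e set \<Rightarrow> nat" where
  "list_rank G g A = abelian_rank (subgroup_generated G (g ` A))"

definition list_mult :: "('a, 'b) monoid_scheme \<Rightarrow> ('e \<Rightarrow> 'a) \<Rightarrow> 'e set \<Rightarrow> nat" where
  "list_mult G g A = card (torsion_elements (quot G g A))"


(* Bases of the matroid on E with rank function rk: the maximal independent sets. *)
definition matroid_bases :: "'e set \<Rightarrow> ('e set \<Rightarrow> nat) \<Rightarrow> 'e set set" where
  "matroid_bases E rk = {B. B \<subseteq> E \<and> rk B = card B \<and>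
     (\<forall>C. B \<subseteq> C \<and> C \<subseteq> E \<and> rk C = card C \<longrightarrow> C = B)}"


(* Polynomials over the rationals in variables indexed by 'e; monomials are exponent vectors. *)
type_synonym 'e rat_mpoly = "('e \<Rightarrow>\<^sub>0 nat) \<Rightarrow>\<^sub>0 rat"

definition mpoly_const :: "rat \<Rightarrow> 'e rat_mpoly" where
  "mpoly_const c = Poly_Mapping.single 0 c"

definition mpoly_var :: "'e \<Rightarrow> 'e rat_mpoly" where
  "mpoly_var e = Poly_Mapping.single (Poly_Mapping.single e 1) 1"

definition arith_tutte ::
  "'e set \<Rightarrow> ('e set \<Rightarrow> nat) \<Rightarrow> ('e set \<Rightarrow> nat) \<Rightarrow> rat \<Rightarrow> 'e rat_mpoly" where
  "arith_tutte E rk m q =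
     (\<Sum>A\<in>Pow E. mpoly_const (of_nat (m A) * q powi (- int (rk A))) * (\<Prod>e\<in>A. mpoly_var e))"

definition Z_list :: "('a, 'b) monoid_scheme \<Rightarrow> 'e set \<Rightarrow> ('e \<Rightarrow> 'a) \<Rightarrow> rat \<Rightarrow> 'e rat_mpoly" where
  "Z_list G E g q = arith_tutte E (list_rank G g) (list_mult G g) q"

definition Z_potts :: "('a, 'b) monoid_scheme \<Rightarrow> 'e set \<Rightarrow> ('e \<Rightarrow> 'a) \<Rightarrow> nat \<Rightarrow> 'e rat_mpoly" where
  "Z_potts G E g q =
     (\<Sum>\<phi>\<in>Hom G (integer_mod_group q).
        \<Prod>e\<in>E. 1 + mpoly_var e * (if \<phi> (g e) = \<one>\<^bsub>integer_mod_group q\<^esub> then 1 else 0))"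

definition list_bases :: "('a, 'b) monoid_scheme \<Rightarrow> 'e set \<Rightarrow> ('e \<Rightarrow> 'a) \<Rightarrow> 'e set set" where
  "list_bases G E g = matroid_bases E (list_rank G g)"

definition Z_A :: "('a, 'b) monoid_scheme \<Rightarrow> 'e set \<Rightarrow> ('e \<Rightarrow> 'a) \<Rightarrow> nat set" where
  "Z_A G E g = {q. q > 0 \<and> (\<forall>B\<in>list_bases G E g.
     \<forall>x\<in>torsion_elements (quot G g B). x [^]\<^bsub>quot G g B\<^esub> q = \<one>\<^bsub>quot G g B\<^esub>)}"

end

(* The coefficient of the monomial v_A in the Potts polynomial is the number of homomorphisms from
   H = G/<L_A> to Z/q. Let F be freely generated by a maximal independent family of r elements
   of H. Every homomorphism kills qF and H/qF is finite. A finite abelian group K has as many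
   homomorphisms to Z/q as elements killed by q, and the elements of H/qF killed by q are
   the t f with q t = 0 in H and f in F/qF. Hence |Hom(H, Z/q)| = q^r |{t. q t = 0}|, which equals
   q^r m(A) exactly if q annihilates the torsion G_A of H. It remains to see that q annihilates
   all G_A once it does so for bases: extend a maximal independent subset I of A to a basis B; if n x lies in
   <L_A>, then q x lies in <L_B>, some multiple of it lies in <L_I>, and comparing coefficients in
   the free group <L_B> puts q x itself in <L_I>. *)

theory Submission
  imports Defs
begin

subsection \<open>Integer linear combinations and independent families\<close>

text \<open>No structure theorem for finitely generated abelian groups is used: a maximal
  independent family stands in for a basis of the free part. Its span need not be a complement of
  the torsion; the count only needs that every element has a positive power in the span. The count
  also shows that the size of such a family does not depend on the choice, so
  \<open>abelian_rank\<close> can be evaluated on any of them. Ranks then add along G/<L_A>, which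
  turns q^(rk G) q^(-rk A) into q^(rank of G/<L_A>) and splits the polynomial identity into one
  cardinality statement for each \<open>A\<close>. For finite groups, the delicate point is
  adjoining one generator x, of order n modulo the part already treated: the image of x must solve a
  linear congruence modulo q, which has exactly n solutions because n divides q. This is why one
  first passes to a group in which all q-th powers are trivial.\<close>

definition lincomb :: "('a, 'b) monoid_scheme \<Rightarrow> ('i \<Rightarrow> 'a) \<Rightarrow> 'i set \<Rightarrow> ('i \<Rightarrow> int) \<Rightarrow> 'a" where
  "lincomb G h I c = (\<Otimes>\<^bsub>G\<^esub>i\<in>I. h i [^]\<^bsub>G\<^esub> c i)"

text \<open>Indexing by \<open>I\<close> makes a list with a repeated element dependent even when
  its underlying set is independent, as the matroid rank requires. For sets of elements,
  \<open>h\<close> is the identity.\<close>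

definition indep_family :: "('a, 'b) monoid_scheme \<Rightarrow> ('i \<Rightarrow> 'a) \<Rightarrow> 'i set \<Rightarrow> bool" where
  "indep_family G h I \<longleftrightarrow> finite I \<and> h \<in> I \<rightarrow> carrier G \<and>
     (\<forall>c. lincomb G h I c = \<one>\<^bsub>G\<^esub> \<longrightarrow> (\<forall>i\<in>I. c i = 0))"

lemma indep_familyD:
  "indep_family G h I \<Longrightarrow> lincomb G h I c = \<one>\<^bsub>G\<^esub> \<Longrightarrow> i \<in> I \<Longrightarrow> c i = 0"
  unfolding indep_family_def by auto

lemma indep_familyI:
  assumes "finite I" "h \<in> I \<rightarrow> carrier G"
    and "\<And>c i. lincomb G h I c = \<one>\<^bsub>G\<^esub> \<Longrightarrow> i \<in> I \<Longrightarrow> c i = 0"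
  shows "indep_family G h I"
  using assms unfolding indep_family_def by auto

lemma int_independent_iff_indep_family: "int_independent G S \<longleftrightarrow> indep_family G (\<lambda>x. x) S"
  unfolding int_independent_def indep_family_def lincomb_def by auto

lemma (in comm_group) lincomb_closed [simp, intro]:
  "h \<in> I \<rightarrow> carrier G \<Longrightarrow> lincomb G h I c \<in> carrier G"
  unfolding lincomb_def by (rule finprod_closed) auto

lemma (in comm_group) lincomb_cong:
  assumes "h \<in> I \<rightarrow> carrier G" "\<And>i. i \<in> I \<Longrightarrow> c i = d i" "\<And>i. i \<in> I \<Longrightarrow> k i = h i"
  shows "lincomb G k I c = lincomb G h I d"
  unfolding lincomb_def using assms by (intro finprod_cong') auto

lemma (in comm_group) lincomb_add:
  assumes "h \<in> I \<rightarrow> carrier G"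
  shows "lincomb G h I (\<lambda>i. c i + d i) = lincomb G h I c \<otimes> lincomb G h I d"
proof -
  have "lincomb G h I (\<lambda>i. c i + d i) = (\<Otimes>i\<in>I. h i [^] c i \<otimes> h i [^] d i)"
    unfolding lincomb_def using assms by (intro finprod_cong') (auto simp: int_pow_mult Pi_iff)
  also have "\<dots> = lincomb G h I c \<otimes> lincomb G h I d"
    unfolding lincomb_def using assms by (intro finprod_multf) auto
  finally show ?thesis .
qed

lemma (in comm_group) lincomb_zero: "h \<in> I \<rightarrow> carrier G \<Longrightarrow> lincomb G h I (\<lambda>_. 0) = \<one>"
  unfolding lincomb_def by simp

lemma (in comm_group) lincomb_insert:
  assumes "finite I" "i \<notin> I" "h \<in> insert i I \<rightarrow> carrier G"
  shows "lincomb G h (insert i I) c = h i [^] c i \<otimes> lincomb G h I c"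
  unfolding lincomb_def using assms by (intro finprod_insert) auto

lemma (in comm_group) lincomb_pow_int:
  assumes "finite I" "h \<in> I \<rightarrow> carrier G"
  shows "lincomb G h I c [^] (k::int) = lincomb G h I (\<lambda>i. c i * k)"
  using assms
proof (induction I)
  case empty
  then show ?case by (simp add: lincomb_def)
next
  case (insert i I)
  then have "h \<in> I \<rightarrow> carrier G" by auto
  with insert show ?case
    by (simp add: lincomb_insert int_pow_distrib int_pow_pow Pi_iff)
qed

lemma (in comm_group) lincomb_pow_nat:
  assumes "finite I" "h \<in> I \<rightarrow> carrier G"
  shows "lincomb G h I c [^] (k::nat) = lincomb G h I (\<lambda>i. c i * int k)"
  using lincomb_pow_int[OF assms, of c "int k"] by (simp add: int_pow_int)

lemma (in comm_group) lincomb_inv: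
  assumes "finite I" "h \<in> I \<rightarrow> carrier G"
  shows "inv (lincomb G h I c) = lincomb G h I (\<lambda>i. - c i)"
  using lincomb_pow_int[OF assms, of c "-1"] assms by (simp add: int_pow_neg)

lemma (in comm_group) lincomb_mono_neutral:
  assumes "finite J" "I \<subseteq> J" "h \<in> J \<rightarrow> carrier G" "\<And>i. i \<in> J - I \<Longrightarrow> c i = 0"
  shows "lincomb G h I c = lincomb G h J c"
  unfolding lincomb_def using assms by (intro finprod_mono_neutral_cong_left) auto

lemma (in comm_group) lincomb_reindex:
  assumes "h \<in> f ` I \<rightarrow> carrier G" "inj_on f I"
  shows "lincomb G h (f ` I) c = lincomb G (h \<circ> f) I (c \<circ> f)"
  unfolding lincomb_def using assms by (subst finprod_reindex) (auto simp: Pi_iff o_def)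

lemma (in comm_group) lincomb_unit:
  assumes "finite I" "h \<in> I \<rightarrow> carrier G" "i \<in> I"
  shows "lincomb G h I (\<lambda>j. if j = i then k else 0) = h i [^] (k::int)"
proof -
  have "lincomb G h {i} (\<lambda>j. if j = i then k else 0) = lincomb G h I (\<lambda>j. if j = i then k else 0)"
    using assms by (intro lincomb_mono_neutral) auto
  moreover have "lincomb G h {i} (\<lambda>j. if j = i then k else 0) = h i [^] k"
    using assms lincomb_insert[of "{}" i h] by (force simp: lincomb_def)
  ultimately show ?thesis by simp
qed

text \<open>The combinations form a subgroup, and a coefficient vector with a single 1 yields each
  \<open>h i\<close>; conversely every combination is a product of powers of generators.\<close>

lemma (in comm_group) generate_eq_lincomb:
  assumes "finite I" "h \<in> I \<rightarrow> carrier G"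
  shows "generate G (h ` I) = range (lincomb G h I)"
proof
  have "subgroup (range (lincomb G h I)) G"
  proof
    show "range (lincomb G h I) \<subseteq> carrier G" using assms by auto
    show "x \<otimes> y \<in> range (lincomb G h I)"
      if "x \<in> range (lincomb G h I)" "y \<in> range (lincomb G h I)" for x y
      using that lincomb_add[OF assms(2), symmetric] by auto
    show "\<one> \<in> range (lincomb G h I)"
      using lincomb_zero[OF assms(2)] by (metis rangeI)
    show "inv x \<in> range (lincomb G h I)" if "x \<in> range (lincomb G h I)" for x
      using that lincomb_inv[OF assms] by auto
  qed
  moreover have "h i \<in> range (lincomb G h I)" if "i \<in> I" for i
  proof -
    have "h i = lincomb G h I (\<lambda>j. if j = i then 1 else 0)"
      using lincomb_unit[OF assms that, of 1] assms that by (simp add: Pi_iff)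
    then show ?thesis by blast
  qed
  ultimately show "generate G (h ` I) \<subseteq> range (lincomb G h I)"
    by (intro generate_subgroup_incl) auto
next
  have sub: "subgroup (generate G (h ` I)) G"
    using assms by (intro generate_is_subgroup) auto
  \<comment> \<open>The induction runs over subfamilies \<open>K\<close>, so that the target, the
    subgroup generated by all of \<open>I\<close>, stays fixed.\<close>
  have "lincomb G h K c \<in> generate G (h ` I)" if "finite K" "K \<subseteq> I" for K c
    using that
  proof (induction K)
    case empty
    then show ?case using subgroup.one_closed[OF sub] by (simp add: lincomb_def)
  next
    case (insert i K)
    have "h i \<in> generate G (h ` I)" using insert.prems by (auto intro: generate.incl)
    moreover have "h \<in> insert i K \<rightarrow> carrier G" using insert.prems assms(2) by auto
    ultimately show ?case using insert subgroup_int_pow_closed[OF sub] subgroup.m_closed[OF sub]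
      by (simp add: lincomb_insert)
  qed
  then show "range (lincomb G h I) \<subseteq> generate G (h ` I)" using assms(1) by auto
qed

text \<open>The product of the exponents of the finitely many generators serves all of them, and the
  elements whose \<open>m\<close>-th power lies in \<open>N\<close> form a subgroup. Torsion modulo
  \<open>N\<close>, known generator by generator, thus becomes a single common exponent.\<close>

lemma (in comm_group) pow_mem_generate_finite_common:
  assumes "finite S" "S \<subseteq> carrier G" "subgroup N G"
    and "\<And>s. s \<in> S \<Longrightarrow> \<exists>n::nat. n > 0 \<and> s [^] n \<in> N"
  shows "\<exists>n::nat. n > 0 \<and> (\<forall>x\<in>generate G S. x [^] n \<in> N)"
proof -
  obtain n where n: "\<And>s. s \<in> S \<Longrightarrow> n s > (0::nat) \<and> s [^] n s \<in> N"
    using assms(4) by metis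
  define m where "m = (\<Prod>s\<in>S. n s)"
  have m: "m > 0" using n unfolding m_def by (simp add: prod_pos)
  have S: "s [^] m \<in> N" if "s \<in> S" for s
  proof -
    have "n s dvd m" unfolding m_def using dvd_prodI[OF assms(1) that, of n] .
    then obtain k where "m = n s * k" by (rule dvdE)
    moreover have "s \<in> carrier G" using that assms(2) by auto
    ultimately have "s [^] m = (s [^] n s) [^] k" by (simp add: nat_pow_pow)
    then show ?thesis using n[OF that] subgroup_int_pow_closed[OF assms(3), of "s [^] n s" "int k"]
      by (simp add: int_pow_int)
  qed
  have "subgroup {x \<in> carrier G. x [^] m \<in> N} G"
    using assms(3) by unfold_locales
      (auto simp: nat_pow_distrib nat_pow_inv subgroup.m_closed subgroup.one_closed subgroup.m_inv_closed)
  then have "generate G S \<subseteq> {x \<in> carrier G. x [^] m \<in> N}"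
    using S assms(2) by (intro generate_subgroup_incl) auto
  with m show ?thesis by auto
qed

lemma (in comm_group) indep_family_inj_on:
  assumes "indep_family G h I"
  shows "inj_on h I"
proof (rule inj_onI, rule ccontr)
  fix i j assume ij: "i \<in> I" "j \<in> I" "h i = h j" "i \<noteq> j"
  have I: "finite I" "h \<in> I \<rightarrow> carrier G" using assms by (auto simp: indep_family_def)
  \<comment> \<open>Equal values at distinct indices would give the nontrivial relation with
    coefficient 1 at \<open>i\<close> and -1 at \<open>j\<close>.\<close>
  have "lincomb G h I (\<lambda>k. (if k = i then 1 else 0) + (if k = j then -1 else 0)) = \<one>"
    using I ij by (auto simp: lincomb_add lincomb_unit int_pow_neg Pi_iff)
  then have "(if i = i then 1 else 0) + (if i = j then -1 else 0) = (0::int)"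
    by (rule indep_familyD[OF assms _ ij(1), of "\<lambda>k. (if k = i then 1 else 0) + (if k = j then -1 else 0)"])
  then show False using ij by simp
qed

lemma (in comm_group) indep_family_image:
  assumes "indep_family G h I"
  shows "indep_family G (\<lambda>x. x) (h ` I)"
proof (rule indep_familyI)
  have h: "h \<in> I \<rightarrow> carrier G" "finite I" using assms by (auto simp: indep_family_def)
  then show "(\<lambda>x. x) \<in> h ` I \<rightarrow> carrier G" "finite (h ` I)" by auto
  fix c x assume c: "lincomb G (\<lambda>x. x) (h ` I) c = \<one>" and "x \<in> h ` I"
  then obtain i where i: "x = h i" "i \<in> I" by blast
  have "lincomb G h I (c \<circ> h) = \<one>"
    using c h indep_family_inj_on[OF assms] by (subst (asm) lincomb_reindex) (auto simp: o_def)
  then show "c x = 0" using indep_familyD[OF assms, of "c \<circ> h" i] i by simp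
qed

lemma (in comm_group) indep_family_eqD:
  assumes "indep_family G h I" "lincomb G h I c = lincomb G h I d" "i \<in> I"
  shows "c i = d i"
proof -
  have h: "h \<in> I \<rightarrow> carrier G" "finite I" using assms(1) by (auto simp: indep_family_def)
  have "lincomb G h I (\<lambda>i. c i + - d i) = lincomb G h I c \<otimes> lincomb G h I (\<lambda>i. - d i)"
    by (rule lincomb_add[OF h(1)])
  also have "\<dots> = lincomb G h I d \<otimes> inv (lincomb G h I d)"
    by (simp only: lincomb_inv[OF h(2,1)] assms(2))
  also have "\<dots> = \<one>" by (rule r_inv) (use h in auto)
  finally have "c i + - d i = 0"
    by (rule indep_familyD[OF assms(1) _ assms(3), of "\<lambda>i. c i + - d i"])
  then show ?thesis by simp
qed

lemma (in group) nat_pow_abs_mem_subgroup: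
  assumes "subgroup N G" "x \<in> carrier G" "x [^] (k::int) \<in> N"
  shows "x [^] nat \<bar>k\<bar> \<in> N"
proof (cases "k \<ge> 0")
  case True
  then show ?thesis using assms by (metis abs_of_nonneg int_nat_eq int_pow_int)
next
  case False
  then have "x [^] (- k) \<in> N"
    using assms by (simp add: int_pow_neg subgroup.m_inv_closed)
  then show ?thesis using False by (metis abs_of_neg int_nat_eq int_pow_int linorder_not_le neg_0_le_iff_le order_less_imp_le)
qed

text \<open>Greedy extension: \<open>k\<close> joins \<open>J\<close> exactly when no positive power
  of \<open>h k\<close> lies in the span of \<open>J\<close>. A relation on
  \<open>insert k J\<close> with a nonzero coefficient at \<open>k\<close> would put such a power
  there, so independence survives. This yields maximality in the form used throughout: the span is
  reached up to a power.\<close>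

lemma (in comm_group) indep_family_extend:
  assumes "finite K" "h \<in> I \<union> K \<rightarrow> carrier G" "indep_family G h I"
  shows "\<exists>J. I \<subseteq> J \<and> J \<subseteq> I \<union> K \<and> indep_family G h J \<and>
    (\<forall>k\<in>K. \<exists>n::nat. n > 0 \<and> h k [^] n \<in> generate G (h ` J))"
  using assms
proof (induction K)
  case empty
  then show ?case by auto
next
  case (insert k K)
  then obtain J where J: "I \<subseteq> J" "J \<subseteq> I \<union> K" "indep_family G h J"
    and gen: "\<forall>k\<in>K. \<exists>n::nat. n > 0 \<and> h k [^] n \<in> generate G (h ` J)"
    by (metis Pi_split_insert_domain Un_insert_right)
  have hJ: "h \<in> J \<rightarrow> carrier G" "finite J" "h k \<in> carrier G"
    using J insert.prems by (auto simp: indep_family_def)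
  have genJ: "subgroup (generate G (h ` J)) G" using hJ by (intro generate_is_subgroup) auto
  show ?case
  proof (cases "\<exists>n::nat. n > 0 \<and> h k [^] n \<in> generate G (h ` J)")
    case True
    with J gen show ?thesis by (intro exI[of _ J]) auto
  next
    case False
    have kJ: "k \<notin> J"
    proof
      assume "k \<in> J"
      then have "h k [^] (1::nat) \<in> generate G (h ` J)" using hJ by (auto intro: generate.incl)
      with False show False by blast
    qed
    have hk: "h \<in> insert k J \<rightarrow> carrier G" using hJ by auto
    have indep: "indep_family G h (insert k J)"
      unfolding indep_family_def
    proof (intro conjI allI impI)
      fix c assume c: "lincomb G h (insert k J) c = \<one>"
      then have eq: "h k [^] c k \<otimes> lincomb G h J c = \<one>"
        using lincomb_insert[OF hJ(2) kJ hk] by simp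
      then have "h k [^] c k = inv (lincomb G h J c)"
        using hJ by (intro inv_equality[symmetric]) auto
      also have "\<dots> \<in> generate G (h ` J)"
        using lincomb_inv[OF hJ(2,1)] generate_eq_lincomb[OF hJ(2,1)] by auto
      finally have *: "h k [^] nat \<bar>c k\<bar> \<in> generate G (h ` J)"
        using nat_pow_abs_mem_subgroup[OF genJ hJ(3)] by blast
      have "c k = 0"
      proof (rule ccontr)
        assume "c k \<noteq> 0"
        then have "nat \<bar>c k\<bar> > 0" by simp
        with * False show False by blast
      qed
      moreover from this eq have "lincomb G h J c = \<one>" using hJ by simp
      then have "\<forall>i\<in>J. c i = 0" using indep_familyD[OF J(3)] by blast
      ultimately show "\<forall>i\<in>insert k J. c i = 0" by simp
    qed (use hJ in auto)
    have "generate G (h ` J) \<subseteq> generate G (h ` insert k J)"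
      by (intro mono_generate) auto
    moreover have "h k [^] (1::nat) \<in> generate G (h ` insert k J)"
      using hJ by (auto intro: generate.incl)
    ultimately have "\<exists>n::nat. n > 0 \<and> h l [^] n \<in> generate G (h ` insert k J)" if "l \<in> insert k K" for l
      using gen that by (cases "l = k") (blast intro: zero_less_one)+
    then show ?thesis using J indep by (intro exI[of _ "insert k J"]) auto
  qed
qed

subsection \<open>Homomorphisms from a finite abelian group to the integers modulo q\<close>

text \<open>Write q = n d and a = n b. Dividing by n turns the congruence into y = b modulo d, whose
  solutions below q are b mod d + k d with k < n.\<close>

lemma card_linear_congruence:
  fixes a :: int and n q :: nat
  assumes "n dvd q" "q > 0" "int n dvd a"
  shows "card {y \<in> {0..<int q}. (int n * y) mod int q = a mod int q} = n"
proof -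
  obtain d where d: "q = n * d" using assms(1) by blast
  obtain b where b: "a = int n * b" using assms(3) by blast
  have pos: "n > 0" "d > 0" using d assms(2) by auto
  have "bij_betw (\<lambda>k. b mod int d + int k * int d) {0..<n}
          {y \<in> {0..<int q}. (int n * y) mod int q = a mod int q}"
  proof (rule bij_betw_byWitness[where f' = "\<lambda>y. nat (y div int d)"])
    have m: "0 \<le> b mod int d" "b mod int d < int d" using pos by auto
    show "\<forall>k\<in>{0..<n}. nat ((b mod int d + int k * int d) div int d) = k"
      using pos m by simp
    have mod: "(int n * y) mod int q = a mod int q \<longleftrightarrow> y mod int d = b mod int d" for y
      unfolding d b using pos by (simp add: mod_mult_mult1)
    show "\<forall>y\<in>{y \<in> {0..<int q}. (int n * y) mod int q = a mod int q}.
            b mod int d + int (nat (y div int d)) * int d = y"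
      unfolding mod using pos by (auto simp: pos_imp_zdiv_nonneg_iff) (metis mod_div_mult_eq)
    show "(\<lambda>k. b mod int d + int k * int d) ` {0..<n} \<subseteq>
            {y \<in> {0..<int q}. (int n * y) mod int q = a mod int q}"
    proof (intro image_subsetI)
      fix k assume k: "k \<in> {0..<n}"
      have "int k * int d + int d \<le> int n * int d"
        using k pos by (metis atLeastLessThan_iff distrib_right mult.commute mult_1 of_nat_Suc of_nat_mono
            mult_right_mono Suc_leI of_nat_0_le_iff add.commute)
      then have "b mod int d + int k * int d < int q" using m unfolding d by simp
      then show "b mod int d + int k * int d \<in> {y \<in> {0..<int q}. (int n * y) mod int q = a mod int q}"
        using m unfolding mod by simp
    qed
    show "(\<lambda>y. nat (y div int d)) ` {y \<in> {0..<int q}. (int n * y) mod int q = a mod int q} \<subseteq> {0..<n}"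
    proof (intro image_subsetI)
      fix y assume "y \<in> {y \<in> {0..<int q}. (int n * y) mod int q = a mod int q}"
      then have y: "y < int n * int d" unfolding d by simp
      have "y div int d * int d \<le> y" using pos by (simp add: minus_mod_eq_div_mult[symmetric])
      with y have "y div int d * int d < int n * int d" by linarith
      then have "y div int d < int n" using pos by simp
      then show "nat (y div int d) \<in> {0..<n}" using pos by auto
    qed
  qed
  from bij_betw_same_card[OF this] show ?thesis by simp
qed

section \<open>Homomorphisms to Z/q as integer-valued functions, extended one generator at a
  time\<close>

lemma Hom_integer_mod_group_iff:
  assumes "q > 0"
  shows "\<phi> \<in> Hom H (integer_mod_group q) \<longleftrightarrow>
    \<phi> \<in> extensional (carrier H) \<and> \<phi> \<in> carrier H \<rightarrow> {0..<int q} \<and>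
    (\<forall>x\<in>carrier H. \<forall>y\<in>carrier H. \<phi> (x \<otimes>\<^bsub>H\<^esub> y) = (\<phi> x + \<phi> y) mod int q)"
  unfolding Hom_def hom_def using assms by (auto simp: carrier_integer_mod_group)

lemma Hom_integer_mod_group_int_pow:
  assumes "group H" "q > 0" "\<phi> \<in> Hom H (integer_mod_group q)" "x \<in> carrier H"
  shows "\<phi> (x [^]\<^bsub>H\<^esub> (k::int)) = (k * \<phi> x) mod int q"
  using hom_int_pow[of \<phi> H "integer_mod_group q" x k] assms
  by (simp add: Hom_def int_pow_integer_mod_group)

text \<open>Take \<open>n\<close> as the least positive exponent that sends \<open>x\<close> into
  \<open>L\<close>; division with remainder shows that the others are its multiples, and
  \<open>q\<close> is one of them.\<close>

lemma (in comm_group) cyclic_extension_decomposition: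
  assumes L: "subgroup L G" and x: "x \<in> carrier G" and "(q::nat) > 0" "x [^] q \<in> L"
  obtains n :: nat where "n > 0" "n dvd q" "\<And>k::int. x [^] k \<in> L \<longleftrightarrow> int n dvd k"
proof -
  define n where "n = (LEAST n::nat. n > 0 \<and> x [^] n \<in> L)"
  have n: "n > 0 \<and> x [^] n \<in> L"
    unfolding n_def by (rule LeastI[of _ q]) (use assms in auto)
  have least: "n \<le> m" if "m > 0" "x [^] m \<in> L" for m :: nat
    unfolding n_def by (rule Least_le) (use that in auto)
  have nint: "x [^] (int n * j) \<in> L" for j
    using subgroup_int_pow_closed[OF L, of "x [^] n" j] n x
    by (metis int_pow_int int_pow_pow)
  have iff: "x [^] k \<in> L \<longleftrightarrow> int n dvd k" for k :: int
  proof
    assume k: "x [^] k \<in> L"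
    have "x [^] (k mod int n) = x [^] (k - int n * (k div int n))"
      by (simp add: minus_mult_div_eq_mod)
    also have "\<dots> = x [^] k \<otimes> inv (x [^] (int n * (k div int n)))"
      using x by (simp add: int_pow_diff)
    also have "\<dots> \<in> L" using k nint L by (simp add: subgroup.m_closed subgroup.m_inv_closed)
    finally have "x [^] nat (k mod int n) \<in> L"
      using n by (simp flip: int_pow_int)
    moreover have "nat (k mod int n) < n" using n by (simp add: nat_less_iff)
    ultimately have "nat (k mod int n) = 0" using least[of "nat (k mod int n)"] by force
    then show "int n dvd k" using n by (metis dvd_eq_mod_eq_0 int_nat_eq nat_0_iff of_nat_0 of_nat_0_less_iff pos_mod_sign)
  next
    assume "int n dvd k"
    then show "x [^] k \<in> L" using nint by (auto elim: dvdE)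
  qed
  have "n dvd q" using iff[of "int q"] assms by (simp add: int_pow_int)
  with that n iff show thesis by blast
qed

(* A homomorphism on L extends to L x^Z by choosing the image y of x subject to n y = phi(x^n), where
   n is the order of x modulo L; as n divides q, there are exactly n choices. *)
lemma (in comm_group) card_Hom_cyclic_extension:
  assumes L: "subgroup L G" and finL: "finite L" and x: "x \<in> carrier G" and q: "q > 0"
    and exponent: "\<And>y. y \<in> carrier G \<Longrightarrow> y [^] q = \<one>"
    and M: "M = {l \<otimes> x [^] i | l i. l \<in> L \<and> i \<in> (UNIV::int set)}"
    and IH: "card (Hom (G\<lparr>carrier := L\<rparr>) (integer_mod_group q)) = card L"
      "finite (Hom (G\<lparr>carrier := L\<rparr>) (integer_mod_group q))"
  shows "subgroup M G" "finite M"
    "card (Hom (G\<lparr>carrier := M\<rparr>) (integer_mod_group q)) = card M"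
    "finite (Hom (G\<lparr>carrier := M\<rparr>) (integer_mod_group q))"
proof -
  let ?HL = "Hom (G\<lparr>carrier := L\<rparr>) (integer_mod_group q)"
  let ?HM = "Hom (G\<lparr>carrier := M\<rparr>) (integer_mod_group q)"
  have "x [^] q \<in> L" using exponent[OF x] subgroup.one_closed[OF L] by simp
  then obtain n where n: "n > 0" "n dvd q" and mem: "\<And>k::int. x [^] k \<in> L \<longleftrightarrow> int n dvd k"
    using cyclic_extension_decomposition[OF L x q] by metis
  have LG: "l \<in> carrier G" if "l \<in> L" for l using subgroup.subset[OF L] that by auto
  have LM: "l \<in> M" if "l \<in> L" for l
    unfolding M using that LG by (auto intro!: exI[of _ l] exI[of _ "0::int"])
  have xM: "x \<in> M"
    unfolding M using x subgroup.one_closed[OF L] by (auto intro!: exI[of _ \<one>] exI[of _ "1::int"])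
  have mult: "(l \<otimes> x [^] i) \<otimes> (l' \<otimes> x [^] j) = (l \<otimes> l') \<otimes> x [^] (i + j)"
    if "l \<in> L" "l' \<in> L" for l l' and i j :: int
    using that LG x by (simp add: int_pow_mult m_ac)
  show subM: "subgroup M G"
  proof
    show "M \<subseteq> carrier G" unfolding M using LG x by auto
    show "\<one> \<in> M" using LM subgroup.one_closed[OF L] by blast
    show "a \<otimes> b \<in> M" if "a \<in> M" "b \<in> M" for a b
      using that mult L unfolding M by (auto intro: subgroup.m_closed) (metis subgroup.m_closed)
    show "inv a \<in> M" if aM: "a \<in> M" for a
    proof -
      obtain l i where a: "a = l \<otimes> x [^] (i::int)" "l \<in> L" using aM unfolding M by auto
      have "inv a = inv l \<otimes> x [^] (- i)"
        using a LG x by (simp add: inv_mult int_pow_neg)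
      then show ?thesis using a L unfolding M by (auto intro: subgroup.m_inv_closed)
    qed
  qed
  have eq_iff: "l \<otimes> x [^] i = l' \<otimes> x [^] j \<longleftrightarrow> l = l' \<otimes> x [^] (j - i)"
    if "l \<in> L" "l' \<in> L" for l l' and i j :: int
  proof -
    have "l' \<otimes> x [^] j = (l' \<otimes> x [^] (j - i)) \<otimes> x [^] i"
      using LG[OF that(2)] x by (simp add: m_assoc flip: int_pow_mult)
    then show ?thesis using LG[OF that(1)] LG[OF that(2)] x by (simp add: r_cancel)
  qed
  have dvd_diff: "int n dvd j - i" if "l \<in> L" "l' \<in> L" "l \<otimes> x [^] i = l' \<otimes> x [^] j" for l l' i j
  proof -
    have "l = l' \<otimes> x [^] (j - i)" using that eq_iff by blast
    then have "x [^] (j - i) = inv l' \<otimes> l"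
      using LG that x by (simp add: m_assoc[symmetric] l_inv)
    also have "\<dots> \<in> L" using that L by (simp add: subgroup.m_closed subgroup.m_inv_closed)
    finally show ?thesis using mem by simp
  qed
  \<comment> \<open>Normal form of the elements of \<open>M\<close>: the exponent of
    \<open>x\<close> is reduced to the range below \<open>n\<close>. It shows that \<open>M\<close>
    is finite with \<open>n\<close> times as many elements as \<open>L\<close>.\<close>
  have bijM: "bij_betw (\<lambda>(l, i). l \<otimes> x [^] int i) (L \<times> {..<n}) M"
  proof (rule bij_betwI')
    fix a b assume "a \<in> L \<times> {..<n}" "b \<in> L \<times> {..<n}"
    then obtain l i l' j where ab: "a = (l, i)" "b = (l', j)" "l \<in> L" "l' \<in> L" "i < n" "j < n" by auto
    have "a = b" if "l \<otimes> x [^] int i = l' \<otimes> x [^] int j"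
    proof -
      have "int n dvd int j - int i" using dvd_diff that ab by blast
      then have "i = j" using ab by (metis mod_eq_dvd_iff mod_less of_nat_eq_iff zmod_int)
      then show ?thesis using eq_iff[OF ab(3,4), of "int i" "int j"] that ab LG by simp
    qed
    then show "((case a of (l, i) \<Rightarrow> l \<otimes> x [^] int i) = (case b of (l, i) \<Rightarrow> l \<otimes> x [^] int i)) = (a = b)"
      using ab by auto
  next
    fix a assume "a \<in> L \<times> {..<n}"
    then show "(case a of (l, i) \<Rightarrow> l \<otimes> x [^] int i) \<in> M" unfolding M by auto
  next
    fix m assume "m \<in> M"
    then obtain l i where m: "m = l \<otimes> x [^] (i::int)" "l \<in> L" unfolding M by auto
    \<comment> \<open>The part of the exponent that is a multiple of \<open>n\<close> gives a power
      of \<open>x\<close> in \<open>L\<close> and is absorbed into the first factor.\<close>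
    define l' where "l' = l \<otimes> x [^] (i - int (nat (i mod int n)))"
    have *: "int (nat (i mod int n)) = i mod int n" using n by simp
    have "x [^] (i - int (nat (i mod int n))) \<in> L"
      unfolding mem * by (simp add: minus_mod_eq_mult_div)
    then have "l' \<in> L" unfolding l'_def using m L by (auto intro: subgroup.m_closed)
    moreover have "m = l' \<otimes> x [^] int (nat (i mod int n))"
      unfolding l'_def using m LG x by (simp add: m_assoc flip: int_pow_mult)
    moreover have "nat (i mod int n) < n" using n by (simp add: nat_less_iff)
    ultimately show "\<exists>a\<in>L \<times> {..<n}. m = (case a of (l, i) \<Rightarrow> l \<otimes> x [^] int i)"
      by (intro bexI[of _ "(l', nat (i mod int n))"]) auto
  qed
  show finM: "finite M" using bij_betw_finite[OF bijM] finL by simp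
  have cardM: "card M = card L * n"
    using bij_betw_same_card[OF bijM] by (simp add: card_cartesian_product)
  have groupL: "group (G\<lparr>carrier := L\<rparr>)" and groupM: "group (G\<lparr>carrier := M\<rparr>)"
    using L subM by (simp_all add: subgroup.subgroup_is_group is_group)
  have powL: "y [^]\<^bsub>G\<lparr>carrier := L\<rparr>\<^esub> (k::int) = y [^] k" if "y \<in> L" for y k
    using int_pow_consistent[OF L that] by simp
  have powM: "y [^]\<^bsub>G\<lparr>carrier := M\<rparr>\<^esub> (k::int) = y [^] k" if "y \<in> M" for y k
    using int_pow_consistent[OF subM that] by simp
  define xn where "xn = x [^] int n"
  have xn: "xn \<in> L" "xn \<in> M" unfolding xn_def using mem LM by auto
  have HL_pow: "\<phi> (y [^] (k::int)) = (k * \<phi> y) mod int q" if "\<phi> \<in> ?HL" "y \<in> L" for \<phi> y k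
    using Hom_integer_mod_group_int_pow[OF groupL q that(1), of y k] that powL by simp
  have HM_pow: "\<phi> (y [^] (k::int)) = (k * \<phi> y) mod int q" if "\<phi> \<in> ?HM" "y \<in> M" for \<phi> y k
    using Hom_integer_mod_group_int_pow[OF groupM q that(1), of y k] that powM by simp
  note HL = Hom_integer_mod_group_iff[OF q, of _ "G\<lparr>carrier := L\<rparr>", simplified]
  note HM = Hom_integer_mod_group_iff[OF q, of _ "G\<lparr>carrier := M\<rparr>", simplified]
  \<comment> \<open>The extension data: a homomorphism on \<open>L\<close> together with an
    admissible image \<open>y\<close> of \<open>x\<close>. Its fibres all have size
    \<open>n\<close>, so \<open>P\<close> has as many elements as \<open>M\<close>.\<close>
  define P where "P = (SIGMA \<phi>:?HL. {y \<in> {0..<int q}. (int n * y) mod int q = \<phi> xn mod int q})"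
  have fibre: "card {y \<in> {0..<int q}. (int n * y) mod int q = \<phi> xn mod int q} = n" if "\<phi> \<in> ?HL" for \<phi>
  proof (rule card_linear_congruence[OF n(2) q])
    \<comment> \<open>The congruence is solvable because \<open>x [^] q\<close> is trivial: with q =
      n d, the \<open>d\<close>-th power of \<open>xn\<close> is the identity, so q divides d times
      the value at \<open>xn\<close>, hence n divides that value.\<close>
    obtain d where d: "q = n * d" using n(2) by blast
    have "xn [^] int d = \<one>"
      unfolding xn_def int_pow_int using x exponent[OF x] by (simp add: nat_pow_pow d)
    then have "\<phi> (xn [^] int d) = \<phi> (xn [^] (0::int))" by simp
    then have "int q dvd int d * \<phi> xn" unfolding HL_pow[OF that xn(1)] by (simp add: mod_eq_0_iff_dvd)
    then show "int n dvd \<phi> xn" using q unfolding d by (simp add: mult.commute)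
  qed
  have "card P = (\<Sum>\<phi>\<in>?HL. n)"
    unfolding P_def using IH(2) fibre by (subst card_SigmaI) (auto intro: finite_subset[of _ "{0..<int q}"])
  then have cardP: "card P = card M" using IH(1) cardM by simp
  have finP: "finite P"
    unfolding P_def using IH(2) by (intro finite_SigmaI) (auto intro: finite_subset[of _ "{0..<int q}"])
  have rep: "\<phi> (l \<otimes> x [^] i) = (\<phi> l + i * \<phi> x) mod int q" if "\<phi> \<in> ?HM" "l \<in> L" for \<phi> l and i :: int
  proof -
    have "x [^] i \<in> M" using xM subM subgroup_int_pow_closed by blast
    then have "\<phi> (l \<otimes> x [^] i) = (\<phi> l + \<phi> (x [^] i)) mod int q"
      using that LM HM by blast
    then show ?thesis using HM_pow[OF that(1) xM, of i] by (simp add: mod_add_right_eq)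
  qed
  have "bij_betw (\<lambda>\<phi>. (restrict \<phi> L, \<phi> x)) ?HM P"
    unfolding bij_betw_def
  proof
    show "inj_on (\<lambda>\<phi>. (restrict \<phi> L, \<phi> x)) ?HM"
    proof (rule inj_onI)
      fix \<phi> \<psi> assume h: "\<phi> \<in> ?HM" "\<psi> \<in> ?HM" "(restrict \<phi> L, \<phi> x) = (restrict \<psi> L, \<psi> x)"
      have "\<phi> m = \<psi> m" if mM: "m \<in> M" for m
      proof -
        obtain l i where m: "m = l \<otimes> x [^] (i::int)" "l \<in> L" using mM unfolding M by auto
        have "\<phi> l = \<psi> l" using h(3) m(2) by (metis prod.inject restrict_apply')
        then show ?thesis using rep[OF h(1) m(2)] rep[OF h(2) m(2)] h(3) m by simp
      qed
      then show "\<phi> = \<psi>" using h HM by (metis extensionalityI)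
    qed
    show "(\<lambda>\<phi>. (restrict \<phi> L, \<phi> x)) ` ?HM = P"
    proof (intro equalityI image_subsetI subsetI)
      fix \<phi> assume h: "\<phi> \<in> ?HM"
      have "restrict \<phi> L \<in> ?HL"
        using h LM subgroup.m_closed[OF L] unfolding HL HM by (auto simp: Pi_iff)
      moreover have "\<phi> x \<in> {0..<int q}" using h xM unfolding HM by auto
      moreover have "(int n * \<phi> x) mod int q = \<phi> xn mod int q"
        using HM_pow[OF h xM, of "int n"] unfolding xn_def by simp
      ultimately show "(restrict \<phi> L, \<phi> x) \<in> P" unfolding P_def using xn by auto
    next
      fix p assume "p \<in> P"
      then obtain \<psi> y where p: "p = (\<psi>, y)" "\<psi> \<in> ?HL" "y \<in> {0..<int q}"
        "(int n * y) mod int q = \<psi> xn mod int q" unfolding P_def by auto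
      have \<psi>: "\<psi> \<in> extensional L" "\<And>l. l \<in> L \<Longrightarrow> 0 \<le> \<psi> l \<and> \<psi> l < int q"
        "\<And>l l'. l \<in> L \<Longrightarrow> l' \<in> L \<Longrightarrow> \<psi> (l \<otimes> l') = (\<psi> l + \<psi> l') mod int q"
        using p(2) unfolding HL by (auto simp: Pi_iff)
      \<comment> \<open>An arbitrary choice of a representation of \<open>m\<close>;
        \<open>wd\<close> shows that the value of the extension does not depend on it.\<close>
      define rp where "rp m = (SOME (l, i). l \<in> L \<and> m = l \<otimes> x [^] (i::int))" for m
      define \<phi> where "\<phi> = (\<lambda>m\<in>M. (\<psi> (fst (rp m)) + snd (rp m) * y) mod int q)"
      \<comment> \<open>Two representations differ by a power \<open>xn [^] k\<close> moved from one
        factor to the other. The congruence satisfied by \<open>y\<close> says that the value of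
        \<psi> at this power is k n y modulo q, which is the change caused in the other
        summand.\<close>
      have wd: "(\<psi> l + i * y) mod int q = (\<psi> l' + j * y) mod int q"
        if ll: "l \<in> L" "l' \<in> L" and eq: "l \<otimes> x [^] i = l' \<otimes> x [^] j" for l l' i j
      proof -
        obtain k where k: "j - i = int n * k" using dvd_diff[OF ll eq] by blast
        have "xn [^] k = x [^] (j - i)" unfolding xn_def k using x by (rule int_pow_pow)
        then have "l = l' \<otimes> xn [^] k"
          using iffD1[OF eq_iff[OF ll] eq] by simp
        moreover have "xn [^] k \<in> L" using xn L subgroup_int_pow_closed by blast
        ultimately have "\<psi> l = (\<psi> l' + \<psi> (xn [^] k)) mod int q" using \<psi>(3) ll by blast
        also have "\<psi> (xn [^] k) = (k * (\<psi> xn mod int q)) mod int q"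
          unfolding HL_pow[OF p(2) xn(1)] by (rule mod_mult_right_eq[symmetric])
        also have "\<dots> = (k * (int n * y)) mod int q"
          unfolding p(4)[symmetric] by (rule mod_mult_right_eq)
        also have "(\<psi> l' + (k * (int n * y)) mod int q) mod int q = (\<psi> l' + k * (int n * y)) mod int q"
          by (rule mod_add_right_eq)
        finally have "(\<psi> l + i * y) mod int q = (\<psi> l' + k * (int n * y) + i * y) mod int q"
          by (simp only: mod_add_left_eq)
        also have "\<psi> l' + k * (int n * y) + i * y = \<psi> l' + (i + int n * k) * y"
          by (simp add: algebra_simps)
        also have "i + int n * k = j" using k by simp
        finally show ?thesis .
      qed
      have \<phi>: "\<phi> (l \<otimes> x [^] i) = (\<psi> l + i * y) mod int q" if l: "l \<in> L" for l i
      proof -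
        have m: "l \<otimes> x [^] i \<in> M" using l unfolding M by auto
        obtain l' j where rp: "rp (l \<otimes> x [^] i) = (l', j)" by fastforce
        have "case rp (l \<otimes> x [^] i) of (l', j) \<Rightarrow> l' \<in> L \<and> l \<otimes> x [^] i = l' \<otimes> x [^] j"
          unfolding rp_def by (rule someI[of _ "(l, i)"]) (simp add: l)
        then have "l' \<in> L" "l' \<otimes> x [^] j = l \<otimes> x [^] i" unfolding rp by simp_all
        then have "(\<psi> l' + j * y) mod int q = (\<psi> l + i * y) mod int q" using wd l by blast
        then show ?thesis unfolding \<phi>_def using m rp by simp
      qed
      have "\<phi> \<in> ?HM"
        unfolding HM
      proof (intro conjI ballI)
        show "\<phi> \<in> extensional M" unfolding \<phi>_def by simp
        show "\<phi> \<in> M \<rightarrow> {0..<int q}" unfolding \<phi>_def using q by auto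
        fix a b assume "a \<in> M" "b \<in> M"
        then obtain l i l' j where ab: "a = l \<otimes> x [^] (i::int)" "b = l' \<otimes> x [^] (j::int)" "l \<in> L" "l' \<in> L"
          unfolding M by auto
        have "\<phi> (a \<otimes> b) = (\<psi> (l \<otimes> l') + (i + j) * y) mod int q"
          unfolding ab mult[OF ab(3,4)] using ab L by (intro \<phi>) (auto intro: subgroup.m_closed)
        also have "\<psi> (l \<otimes> l') = (\<psi> l + \<psi> l') mod int q" using \<psi>(3) ab by blast
        finally show "\<phi> (a \<otimes> b) = (\<phi> a + \<phi> b) mod int q"
          unfolding ab \<phi>[OF ab(3)] \<phi>[OF ab(4)] mod_add_left_eq mod_add_right_eq
          by (simp add: algebra_simps)
      qed
      moreover have "restrict \<phi> L = \<psi>"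
      proof (rule extensionalityI)
        show "\<psi> \<in> extensional L" by fact
        fix l assume l: "l \<in> L"
        have "\<phi> l = \<psi> l mod int q" using \<phi>[OF l, of 0] LG[OF l] by simp
        then show "restrict \<phi> L l = \<psi> l" using \<psi>(2)[OF l] l by simp
      qed simp
      moreover have "\<phi> x = y"
      proof -
        have "\<psi> \<one> = 0" using HL_pow[OF p(2) subgroup.one_closed[OF L], of 0] by simp
        then show ?thesis using \<phi>[OF subgroup.one_closed[OF L], of 1] x p(3) by simp
      qed
      ultimately show "p \<in> (\<lambda>\<phi>. (restrict \<phi> L, \<phi> x)) ` ?HM" unfolding p(1) by (intro image_eqI[of _ _ \<phi>]) simp_all
    qed
  qed
  note bij = this
  show "card ?HM = card M" using bij_betw_same_card[OF bij] cardP by (rule trans)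
  show "finite ?HM" using bij_betw_finite[OF bij] finP by (rule iffD2)
qed

text \<open>The elements of \<open>S\<close> are adjoined one after another with
  \<open>card_Hom_cyclic_extension\<close>. Asking only for some \<open>L\<close> above
  \<open>S\<close> avoids describing the subgroup that arises; for \<open>S = carrier G\<close>
  there is just one choice.\<close>

lemma (in comm_group) ex_subgroup_card_Hom_exponent:
  assumes "q > 0" "finite S" "S \<subseteq> carrier G" and exponent: "\<And>y. y \<in> carrier G \<Longrightarrow> y [^] q = \<one>"
  shows "\<exists>L. subgroup L G \<and> S \<subseteq> L \<and> finite L \<and> finite (Hom (G\<lparr>carrier := L\<rparr>) (integer_mod_group q)) \<and>
    card (Hom (G\<lparr>carrier := L\<rparr>) (integer_mod_group q)) = card L"
  using assms(2,3)
proof (induction S)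
  case empty
  have "Hom (G\<lparr>carrier := {\<one>}\<rparr>) (integer_mod_group q) = {\<lambda>x\<in>{\<one>}. 0}"
  proof (intro equalityI subsetI)
    fix \<phi> assume \<phi>: "\<phi> \<in> Hom (G\<lparr>carrier := {\<one>}\<rparr>) (integer_mod_group q)"
    have "group (G\<lparr>carrier := {\<one>}\<rparr>)" using triv_subgroup is_group by (rule subgroup.subgroup_is_group)
    from Hom_integer_mod_group_int_pow[OF this assms(1) \<phi>, of \<one> 0] have "\<phi> \<one> = 0" by simp
    moreover have "\<phi> \<in> extensional {\<one>}" using \<phi> by (simp add: Hom_def)
    ultimately have "\<phi> = (\<lambda>x\<in>{\<one>}. 0)" by (intro extensionalityI[of _ "{\<one>}"]) auto
    then show "\<phi> \<in> {\<lambda>x\<in>{\<one>}. 0}" by simp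
  qed (use assms(1) in \<open>auto simp: Hom_integer_mod_group_iff\<close>)
  then show ?case by (intro exI[of _ "{\<one>}"]) (simp add: triv_subgroup)
next
  case (insert x S)
  then obtain L where L: "subgroup L G" "S \<subseteq> L" "finite L"
    "finite (Hom (G\<lparr>carrier := L\<rparr>) (integer_mod_group q))"
    "card (Hom (G\<lparr>carrier := L\<rparr>) (integer_mod_group q)) = card L" by auto
  define M where "M = {l \<otimes> x [^] i | l i. l \<in> L \<and> i \<in> (UNIV::int set)}"
  have x: "x \<in> carrier G" using insert.prems by simp
  note * = card_Hom_cyclic_extension[OF L(1,3) x assms(1) exponent M_def L(5,4)]
  have "l \<in> M" if "l \<in> L" for l
    unfolding M_def using that subgroup.subset[OF L(1)] by (auto intro!: exI[of _ l] exI[of _ "0::int"])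
  moreover have "x \<in> M"
    unfolding M_def using x subgroup.one_closed[OF L(1)] by (auto intro!: exI[of _ \<one>] exI[of _ "1::int"])
  ultimately have "insert x S \<subseteq> M" using L(2) by auto
  then show ?case using * by (intro exI[of _ M]) simp
qed

lemma (in comm_group) card_Hom_exponent:
  assumes "q > 0" "finite (carrier G)" "\<And>y. y \<in> carrier G \<Longrightarrow> y [^] q = \<one>"
  shows "finite (Hom G (integer_mod_group q))"
    "card (Hom G (integer_mod_group q)) = card (carrier G)"
proof -
  obtain L where L: "subgroup L G" "carrier G \<subseteq> L"
    "finite (Hom (G\<lparr>carrier := L\<rparr>) (integer_mod_group q))"
    "card (Hom (G\<lparr>carrier := L\<rparr>) (integer_mod_group q)) = card L"
    using ex_subgroup_card_Hom_exponent[OF assms(1,2) order_refl assms(3)] by blast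
  then have "L = carrier G" using subgroup.subset by blast
  then show "finite (Hom G (integer_mod_group q))"
    "card (Hom G (integer_mod_group q)) = card (carrier G)"
    using L by simp_all
qed

section \<open>Homomorphisms and powers in factor groups, and the count for arbitrary finite abelian
  groups\<close>

lemma (in normal) bij_betw_Hom_FactGroup:
  assumes "group C"
  shows "bij_betw (\<lambda>\<psi>. \<lambda>x\<in>carrier G. \<psi> (H #> x)) (Hom (G Mod H) C)
           {\<phi> \<in> Hom G C. \<forall>x\<in>H. \<phi> x = \<one>\<^bsub>C\<^esub>}"
  unfolding bij_betw_def
proof
  have HG: "x \<in> carrier G" if "x \<in> H" for x using that subset by auto
  show "inj_on (\<lambda>\<psi>. \<lambda>x\<in>carrier G. \<psi> (H #> x)) (Hom (G Mod H) C)"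
  proof (rule inj_onI)
    fix \<psi> \<psi>' assume h: "\<psi> \<in> Hom (G Mod H) C" "\<psi>' \<in> Hom (G Mod H) C"
      "(\<lambda>x\<in>carrier G. \<psi> (H #> x)) = (\<lambda>x\<in>carrier G. \<psi>' (H #> x))"
    have eq: "\<psi> (H #> x) = \<psi>' (H #> x)" if "x \<in> carrier G" for x
      using fun_cong[OF h(3), of x] that by simp
    show "\<psi> = \<psi>'"
      by (rule extensionalityI[of _ "carrier (G Mod H)"])
        (use h eq in \<open>auto simp: Hom_def carrier_FactGroup\<close>)
  qed
  show "(\<lambda>\<psi>. \<lambda>x\<in>carrier G. \<psi> (H #> x)) ` Hom (G Mod H) C = {\<phi> \<in> Hom G C. \<forall>x\<in>H. \<phi> x = \<one>\<^bsub>C\<^esub>}"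
  proof (intro equalityI image_subsetI subsetI)
    fix \<psi> assume "\<psi> \<in> Hom (G Mod H) C"
    then have \<psi>: "\<psi> \<in> hom (G Mod H) C" by (simp add: Hom_def)
    have "compose (carrier G) \<psi> (\<lambda>x. H #> x) \<in> hom G C"
      using hom_compose[OF r_coset_hom_Mod \<psi>] .
    then have "(\<lambda>x\<in>carrier G. \<psi> (H #> x)) \<in> hom G C"
      unfolding compose_def by simp
    moreover have "\<psi> (H #> x) = \<one>\<^bsub>C\<^esub>" if "x \<in> H" for x
      using hom_one[OF \<psi> factorgroup_is_group assms] rcos_const[OF is_group that] by simp
    ultimately show "(\<lambda>x\<in>carrier G. \<psi> (H #> x)) \<in> {\<phi> \<in> Hom G C. \<forall>x\<in>H. \<phi> x = \<one>\<^bsub>C\<^esub>}"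
      using HG by (auto simp: Hom_def)
  next
    fix \<phi> assume "\<phi> \<in> {\<phi> \<in> Hom G C. \<forall>x\<in>H. \<phi> x = \<one>\<^bsub>C\<^esub>}"
    then have \<phi>: "\<phi> \<in> hom G C" "\<phi> \<in> extensional (carrier G)" "\<And>x. x \<in> H \<Longrightarrow> \<phi> x = \<one>\<^bsub>C\<^esub>"
      by (auto simp: Hom_def)
    interpret \<phi>: group_hom G C \<phi>
      using \<phi>(1) assms is_group by (simp add: group_hom_def group_hom_axioms_def)
    have "\<phi> x = \<phi> y" if "x \<in> carrier G" "y \<in> carrier G" "H #> x = H #> y" for x y
    proof -
      have "x \<in> H #> y" using that rcos_self[OF that(1)] subgroup_axioms by auto
      then have "x \<otimes> inv y \<in> H" using rcos_module_imp[OF is_group that(2)] by blast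
      then have "\<phi> (x \<otimes> inv y) = \<one>\<^bsub>C\<^esub>" by (rule \<phi>(3))
      then have "\<phi> x \<otimes>\<^bsub>C\<^esub> inv\<^bsub>C\<^esub> \<phi> y = \<one>\<^bsub>C\<^esub>" using that(1,2) by simp
      then show ?thesis using \<phi>.H.right_cancel[of "inv\<^bsub>C\<^esub> \<phi> y" "\<phi> x" "\<phi> y"] that(1,2) by simp
    qed
    then obtain \<psi> where \<psi>: "\<psi> \<in> hom (G Mod H) C" "\<And>x. x \<in> carrier G \<Longrightarrow> \<psi> (H #> x) = \<phi> x"
      using FactGroup_universal[OF \<phi>(1) normal_axioms] by metis
    \<comment> \<open>The universal property leaves \<psi> unconstrained outside the carrier,
      whereas \<open>Hom\<close> demands the default value there.\<close>
    define \<psi>' where "\<psi>' = restrict \<psi> (carrier (G Mod H))"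
    interpret GH: group "G Mod H" by (rule factorgroup_is_group)
    have "\<psi>' \<in> Hom (G Mod H) C"
      using \<psi>(1) GH.m_closed unfolding Hom_def \<psi>'_def hom_def by auto
    moreover have "\<phi> = (\<lambda>x\<in>carrier G. \<psi>' (H #> x))"
    proof (rule extensionalityI[of _ "carrier G"])
      fix x assume "x \<in> carrier G"
      then show "\<phi> x = (\<lambda>x\<in>carrier G. \<psi>' (H #> x)) x"
        using \<psi>(2) by (simp add: \<psi>'_def carrier_FactGroup)
    qed (use \<phi> in auto)
    ultimately show "\<phi> \<in> (\<lambda>\<psi>. \<lambda>x\<in>carrier G. \<psi> (H #> x)) ` Hom (G Mod H) C" by blast
  qed
qed

lemma (in comm_group) FactGroup_pow_eq_one_iff:
  assumes "subgroup N G" "x \<in> carrier G"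
  shows "(N #> x) [^]\<^bsub>G Mod N\<^esub> (n::nat) = \<one>\<^bsub>G Mod N\<^esub> \<longleftrightarrow> x [^] n \<in> N"
proof -
  interpret N: normal N G using assms(1) by (rule subgroup_imp_normal)
  have "(N #> x) [^]\<^bsub>G Mod N\<^esub> n = N #> x [^] n" using N.FactGroup_pow assms(2) by metis
  also have "\<dots> = N \<longleftrightarrow> x [^] n \<in> N"
    using assms(2) coset_join1[OF _ _ assms(1), of "x [^] n"] N.rcos_const[OF is_group, of "x [^] n"]
    by auto
  finally show ?thesis by simp
qed

lemma (in comm_group) subgroup_pow_image:
  assumes "subgroup N G"
  shows "subgroup ((\<lambda>x. x [^] (q::nat)) ` N) G"
proof
  have NG: "x \<in> carrier G" if "x \<in> N" for x using that subgroup.subset[OF assms] by auto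
  show "(\<lambda>x. x [^] q) ` N \<subseteq> carrier G" using NG by auto
  show "\<one> \<in> (\<lambda>x. x [^] q) ` N" using subgroup.one_closed[OF assms] by (force intro: image_eqI[of _ _ \<one>])
  show "inv x \<in> (\<lambda>x. x [^] q) ` N" if "x \<in> (\<lambda>x. x [^] q) ` N" for x
  proof -
    from that obtain a where a: "a \<in> N" "x = a [^] q" by blast
    then have "inv x = (inv a) [^] q" using NG by (simp add: nat_pow_inv)
    with a show ?thesis using subgroup.m_inv_closed[OF assms] by blast
  qed
  show "x \<otimes> y \<in> (\<lambda>x. x [^] q) ` N"
    if "x \<in> (\<lambda>x. x [^] q) ` N" "y \<in> (\<lambda>x. x [^] q) ` N" for x y
  proof -
    from that obtain a b where ab: "a \<in> N" "x = a [^] q" "b \<in> N" "y = b [^] q" by blast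
    then have "x \<otimes> y = (a \<otimes> b) [^] q" using NG by (simp add: nat_pow_distrib)
    with ab show ?thesis using subgroup.m_closed[OF assms] by blast
  qed
qed

text \<open>Let \<open>N\<close> be the group of \<open>q\<close>-th powers. Homomorphisms to Z/q
  kill \<open>N\<close>, and in the quotient by \<open>N\<close> all \<open>q\<close>-th powers are
  trivial, so their number is the index of \<open>N\<close>. The \<open>q\<close>-th power map is
  onto \<open>N\<close>, so by Lagrange this index equals the order of its kernel.\<close>

lemma (in comm_group) card_Hom_finite:
  assumes q: "q > 0" and fin: "finite (carrier G)"
  shows "finite (Hom G (integer_mod_group q))"
    "card (Hom G (integer_mod_group q)) = card {x \<in> carrier G. x [^] q = \<one>}"
proof -
  define N where "N = (\<lambda>x. x [^] q) ` carrier G"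
  have sub: "subgroup N G" unfolding N_def by (rule subgroup_pow_image[OF subgroup_self])
  interpret N: normal N G using sub by (rule subgroup_imp_normal)
  interpret Q: comm_group "G Mod N" using sub by (rule abelian_FactGroup)
  have finQ: "finite (carrier (G Mod N))" using fin by (simp add: carrier_FactGroup)
  have expQ: "y [^]\<^bsub>G Mod N\<^esub> q = \<one>\<^bsub>G Mod N\<^esub>" if y: "y \<in> carrier (G Mod N)" for y
  proof -
    obtain x where "y = N #> x" "x \<in> carrier G" using y by (auto simp: carrier_FactGroup)
    then show ?thesis using FactGroup_pow_eq_one_iff[OF sub] by (simp add: N_def)
  qed
  have "\<phi> x = 0" if \<phi>: "\<phi> \<in> Hom G (integer_mod_group q)" and x: "x \<in> N" for \<phi> x
  proof -
    obtain y where "x = y [^] q" "y \<in> carrier G" using x by (auto simp: N_def)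
    then show ?thesis
      using Hom_integer_mod_group_int_pow[OF is_group q \<phi>, of y "int q"] by (simp add: int_pow_int)
  qed
  then have "{\<phi> \<in> Hom G (integer_mod_group q). \<forall>x\<in>N. \<phi> x = \<one>\<^bsub>integer_mod_group q\<^esub>} = Hom G (integer_mod_group q)"
    by auto
  then have bij: "bij_betw (\<lambda>\<psi>. \<lambda>x\<in>carrier G. \<psi> (N #> x)) (Hom (G Mod N) (integer_mod_group q))
      (Hom G (integer_mod_group q))"
    using N.bij_betw_Hom_FactGroup[OF group_integer_mod_group[of q]] by simp
  show "finite (Hom G (integer_mod_group q))"
    using bij_betw_finite[OF bij] Q.card_Hom_exponent(1)[OF q finQ expQ] by blast
  have 1: "card (Hom G (integer_mod_group q)) = card (carrier (G Mod N))"
    using bij_betw_same_card[OF bij] Q.card_Hom_exponent(2)[OF q finQ expQ] by simp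
  have 2: "card (carrier (G Mod N)) * card N = order G"
    using lagrange[OF sub] by (simp add: FactGroup_def)
  have grpN: "group (G\<lparr>carrier := N\<rparr>)" using sub is_group by (rule subgroup.subgroup_is_group)
  have homN: "(\<lambda>x. x [^] q) \<in> hom G (G\<lparr>carrier := N\<rparr>)"
    by (auto simp: hom_def N_def nat_pow_distrib)
  have p: "group_hom G (G\<lparr>carrier := N\<rparr>) (\<lambda>x. x [^] q)"
    using is_group grpN homN by (simp add: group_hom_def group_hom_axioms_def)
  define T where "T = kernel G (G\<lparr>carrier := N\<rparr>) (\<lambda>x. x [^] q)"
  have T: "T = {x \<in> carrier G. x [^] q = \<one>}" by (simp add: T_def kernel_def)
  have subT: "subgroup T G" unfolding T_def by (rule group_hom.subgroup_kernel[OF p])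
  have "G Mod T \<cong> G\<lparr>carrier := N\<rparr>"
    unfolding T_def by (rule group_hom.FactGroup_iso[OF p]) (simp add: N_def)
  then have "card (carrier (G Mod T)) = card N"
    unfolding is_iso_def iso_def by (auto dest: bij_betw_same_card)
  moreover have "card (carrier (G Mod T)) * card T = order G"
    using lagrange[OF subT] by (simp add: FactGroup_def)
  moreover have "card N > 0" using fin unfolding N_def by (auto simp: card_gt_0_iff)
  ultimately have "card N * card (carrier (G Mod N)) = card N * card T" "card N > 0"
    using 2 by (simp_all add: mult.commute)
  then have "card (carrier (G Mod N)) = card T" by simp
  then show "card (Hom G (integer_mod_group q)) = card {x \<in> carrier G. x [^] q = \<one>}" using 1 T by simp
qed

text \<open>Coefficients may be reduced modulo \<open>n\<close>, so finitely many combinations of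
  the generators exhaust the group.\<close>

lemma (in comm_group) finite_carrier_of_exponent:
  assumes "finite S" "S \<subseteq> carrier G" "generate G S = carrier G"
    and "n > 0" "\<And>x. x \<in> carrier G \<Longrightarrow> x [^] (n::nat) = \<one>"
  shows "finite (carrier G)"
proof -
  have h: "(\<lambda>x. x) \<in> S \<rightarrow> carrier G" using assms(2) by auto
  have pow: "x [^] (k::int) = x [^] (k mod int n)" if x: "x \<in> carrier G" for x k
  proof -
    have "x [^] k = x [^] (int n * (k div int n) + k mod int n)" by simp
    also have "\<dots> = (x [^] int n) [^] (k div int n) \<otimes> x [^] (k mod int n)"
      using x by (simp only: int_pow_mult int_pow_pow)
    also have "\<dots> = x [^] (k mod int n)" using x assms(5)[OF x] by (simp add: int_pow_int)
    finally show ?thesis .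
  qed
  have "carrier G \<subseteq> lincomb G (\<lambda>x. x) S ` (PiE S (\<lambda>_. {0..<int n}))"
  proof
    fix x assume "x \<in> carrier G"
    then obtain c where c: "x = lincomb G (\<lambda>x. x) S c"
      using assms(3) generate_eq_lincomb[OF assms(1) h] by auto
    have "x = lincomb G (\<lambda>x. x) S (\<lambda>s\<in>S. c s mod int n)"
      unfolding c lincomb_def using h pow by (intro finprod_cong') auto
    then show "x \<in> lincomb G (\<lambda>x. x) S ` (PiE S (\<lambda>_. {0..<int n}))"
      using assms(4) by (intro image_eqI) auto
  qed
  moreover have "finite (lincomb G (\<lambda>x. x) S ` (PiE S (\<lambda>_. {0..<int n})))"
    using assms(1) by (intro finite_imageI finite_PiE) auto
  ultimately show ?thesis by (rule finite_subset)
qed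

lemma (in comm_group) finite_FactGroup:
  assumes "finite S" "S \<subseteq> carrier G" "generate G S = carrier G" "subgroup N G"
    and "n > 0" "\<And>x. x \<in> carrier G \<Longrightarrow> x [^] (n::nat) \<in> N"
  shows "finite (carrier (G Mod N))"
proof -
  interpret N: normal N G using assms(4) by (rule subgroup_imp_normal)
  interpret Q: comm_group "G Mod N" using assms(4) by (rule abelian_FactGroup)
  interpret p: group_hom G "G Mod N" "\<lambda>x. N #> x"
    by unfold_locales (rule N.r_coset_hom_Mod)
  show ?thesis
  proof (rule Q.finite_carrier_of_exponent)
    show "finite ((\<lambda>x. N #> x) ` S)" using assms(1) by simp
    show "(\<lambda>x. N #> x) ` S \<subseteq> carrier (G Mod N)" using assms(2) by (auto simp: carrier_FactGroup)
    show "generate (G Mod N) ((\<lambda>x. N #> x) ` S) = carrier (G Mod N)"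
      using p.generate_img[OF assms(2)] assms(3) by (simp add: carrier_FactGroup)
    show "n > 0" by fact
    show "y [^]\<^bsub>G Mod N\<^esub> n = \<one>\<^bsub>G Mod N\<^esub>" if "y \<in> carrier (G Mod N)" for y
      using that FactGroup_pow_eq_one_iff[OF assms(4)] assms(6) by (auto simp: carrier_FactGroup)
  qed
qed

subsection \<open>Counting homomorphisms and the rank\<close>

lemma (in comm_group) lincomb_extend:
  assumes "finite J" "I \<subseteq> J" "h \<in> J \<rightarrow> carrier G"
  shows "lincomb G h I c = lincomb G h J (\<lambda>i. if i \<in> I then c i else 0)"
proof -
  have "lincomb G h I c = lincomb G h I (\<lambda>i. if i \<in> I then c i else 0)"
    by (rule lincomb_cong) (use assms in auto)
  also have "\<dots> = lincomb G h J (\<lambda>i. if i \<in> I then c i else 0)"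
    by (rule lincomb_mono_neutral) (use assms in auto)
  finally show ?thesis .
qed

text \<open>Comparing coefficients in the free group spanned by \<open>J\<close> gives n c_i = 0
  outside \<open>I\<close>. In other words, the span of \<open>J\<close> is torsion-free modulo the
  span of a subfamily; the finiteness of torsion, the rank of quotients, the maximality of bases and
  the passage from bases to all subsets rest on this.\<close>

lemma (in comm_group) indep_family_pow_mem_generate:
  assumes "indep_family G h J" "I \<subseteq> J" "lincomb G h J c [^] (n::nat) \<in> generate G (h ` I)" "n > 0"
    and i: "i \<in> J" "i \<notin> I"
  shows "c i = 0"
proof -
  have h: "h \<in> J \<rightarrow> carrier G" "finite J" using assms(1) by (auto simp: indep_family_def)
  have hI: "h \<in> I \<rightarrow> carrier G" "finite I" using h assms(2) by (auto intro: finite_subset)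
  obtain d where "lincomb G h J c [^] n = lincomb G h I d"
    using assms(3) generate_eq_lincomb[OF hI(2,1)] by auto
  then have "lincomb G h J (\<lambda>i. c i * int n) = lincomb G h J (\<lambda>i. if i \<in> I then d i else 0)"
    using lincomb_pow_nat[OF h(2,1)] lincomb_extend[OF h(2) assms(2) h(1)] by simp
  from indep_family_eqD[OF assms(1) this i(1)] i(2) assms(4) show ?thesis by simp
qed

lemma (in comm_group) card_Hom_indep_family:
  assumes q: "q > 0" and S: "finite S" "S \<subseteq> carrier G" "generate G S = carrier G"
    and J: "indep_family G h J"
    and tors: "\<And>x. x \<in> carrier G \<Longrightarrow> \<exists>n::nat. n > 0 \<and> x [^] n \<in> generate G (h ` J)"
  shows "finite (Hom G (integer_mod_group q))"
    and "finite {x \<in> carrier G. x [^] q = \<one>}"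
    and "card (Hom G (integer_mod_group q)) = q ^ card J * card {x \<in> carrier G. x [^] q = \<one>}"
proof -
  have h: "h \<in> J \<rightarrow> carrier G" "finite J" using J by (auto simp: indep_family_def)
  define F where "F = generate G (h ` J)"
  have F: "F = range (lincomb G h J)" unfolding F_def by (rule generate_eq_lincomb[OF h(2,1)])
  have subF: "subgroup F G" unfolding F_def using h by (intro generate_is_subgroup) auto
  define N where "N = (\<lambda>x. x [^] q) ` F"
  have sub: "subgroup N G" unfolding N_def by (rule subgroup_pow_image[OF subF])
  have N: "x \<in> N \<longleftrightarrow> (\<exists>d. x = lincomb G h J (\<lambda>i. d i * int q))" for x
    unfolding N_def F image_image lincomb_pow_nat[OF h(2,1)] by auto
  interpret N: normal N G using sub by (rule subgroup_imp_normal)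
  interpret Q: comm_group "G Mod N" using sub by (rule abelian_FactGroup)
  obtain m where m: "m > (0::nat)" "\<And>x. x \<in> carrier G \<Longrightarrow> x [^] m \<in> F"
    using pow_mem_generate_finite_common[OF S(1,2) subF] tors S(2,3) unfolding F_def by blast
  have finQ: "finite (carrier (G Mod N))"
  proof (rule finite_FactGroup[OF S sub])
    \<comment> \<open>The power \<open>m\<close> brings every element into \<open>F\<close>, and a
      further power \<open>q\<close> brings it into \<open>N\<close>, so \<open>m * q\<close> is a
      common exponent modulo \<open>N\<close>.\<close>
    show "m * q > 0" using m q by simp
    fix x assume x: "x \<in> carrier G"
    then have "x [^] (m * q) = (x [^] m) [^] q" by (simp add: nat_pow_pow)
    then show "x [^] (m * q) \<in> N" using m(2)[OF x] unfolding N_def by blast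
  qed
  have "\<phi> x = 0" if \<phi>: "\<phi> \<in> Hom G (integer_mod_group q)" and x: "x \<in> N" for \<phi> x
  proof -
    obtain y where y: "x = y [^] q" "y \<in> F" using x by (auto simp: N_def)
    moreover from y(2) have "y \<in> carrier G" using subgroup.subset[OF subF] by auto
    ultimately show ?thesis
      using Hom_integer_mod_group_int_pow[OF is_group q \<phi>, of y "int q"] by (simp add: int_pow_int)
  qed
  then have "{\<phi> \<in> Hom G (integer_mod_group q). \<forall>x\<in>N. \<phi> x = \<one>\<^bsub>integer_mod_group q\<^esub>} = Hom G (integer_mod_group q)"
    by auto
  then have bij: "bij_betw (\<lambda>\<psi>. \<lambda>x\<in>carrier G. \<psi> (N #> x)) (Hom (G Mod N) (integer_mod_group q))
      (Hom G (integer_mod_group q))"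
    using N.bij_betw_Hom_FactGroup[OF group_integer_mod_group[of q]] by simp
  show "finite (Hom G (integer_mod_group q))"
    using bij_betw_finite[OF bij] Q.card_Hom_finite(1)[OF q finQ] by blast
  define T where "T = {x \<in> carrier G. x [^] q = \<one>}"
  define C where "C = (PiE J (\<lambda>_. {0..<int q}))"
  define TQ where "TQ = {Y \<in> carrier (G Mod N). Y [^]\<^bsub>G Mod N\<^esub> q = \<one>\<^bsub>G Mod N\<^esub>}"
  have card1: "card (Hom G (integer_mod_group q)) = card TQ"
    using bij_betw_same_card[OF bij] Q.card_Hom_finite(2)[OF q finQ] unfolding TQ_def by simp
  have TG: "t \<in> carrier G" "t [^] q = \<one>" if "t \<in> T" for t using that by (auto simp: T_def)
  have L: "lincomb G h J c \<in> carrier G" for c using h by auto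
  have LC: "lincomb G h J c [^] q = lincomb G h J (\<lambda>i. c i * int q)" for c
    by (rule lincomb_pow_nat[OF h(2,1)])
  have bij2: "bij_betw (\<lambda>(t, c). N #> (t \<otimes> lincomb G h J c)) (T \<times> C) TQ"
    unfolding bij_betw_def
  proof
    show "inj_on (\<lambda>(t, c). N #> (t \<otimes> lincomb G h J c)) (T \<times> C)"
    proof (rule inj_onI, clarify)
      fix t c t' c'
      assume a: "t \<in> T" "c \<in> C" "t' \<in> T" "c' \<in> C"
        and eq: "N #> (t \<otimes> lincomb G h J c) = N #> (t' \<otimes> lincomb G h J c')"
      have "t \<otimes> lincomb G h J c \<in> N #> (t' \<otimes> lincomb G h J c')"
        unfolding eq[symmetric] using TG a L sub by (intro rcos_self) auto
      then obtain y where "y \<in> N" and y: "t \<otimes> lincomb G h J c = y \<otimes> (t' \<otimes> lincomb G h J c')"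
        unfolding r_coset_def by auto
      then obtain d where d: "y = lincomb G h J (\<lambda>i. d i * int q)" using N by blast
      \<comment> \<open>Raising to the power \<open>q\<close> removes the torsion parts
        \<open>t\<close> and \<open>t'\<close> and leaves a relation inside the free span, where
        coefficients can be compared.\<close>
      have "(t \<otimes> lincomb G h J c) [^] q = lincomb G h J (\<lambda>i. c i * int q)"
        using TG a L by (simp add: nat_pow_distrib LC)
      moreover have "(y \<otimes> (t' \<otimes> lincomb G h J c')) [^] q = lincomb G h J (\<lambda>i. d i * int q * int q + c' i * int q)"
        unfolding d using TG a L by (simp add: nat_pow_distrib LC lincomb_add[OF h(1)])
      ultimately have eqL: "lincomb G h J (\<lambda>i. c i * int q) = lincomb G h J (\<lambda>i. d i * int q * int q + c' i * int q)"
        using y by simp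
      have cd: "c i = c' i \<and> d i = 0" if i: "i \<in> J" for i
      proof -
        have "c i * int q = (d i * int q + c' i) * int q"
          using indep_family_eqD[OF J eqL i] by (simp add: algebra_simps)
        then have *: "c i = d i * int q + c' i" using q by simp
        \<comment> \<open>Both coefficients are already reduced modulo \<open>q\<close>, so they
          agree and the coefficient of \<open>d\<close> vanishes; hence \<open>y\<close> is the
          identity.\<close>
        have "0 \<le> c i" "c i < int q" "0 \<le> c' i" "c' i < int q" using a i by (auto simp: C_def PiE_iff)
        then have "c i = c' i" using arg_cong[OF *, of "\<lambda>x. x mod int q"] by simp
        then show ?thesis using * q by simp
      qed
      have cc: "c = c'"
        by (rule PiE_ext[OF a(2,4)[unfolded C_def]]) (use cd in blast)
      have "y = lincomb G h J (\<lambda>_. 0)"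
        unfolding d by (rule lincomb_cong) (use h cd in auto)
      then have "y = \<one>" using lincomb_zero[OF h(1)] by simp
      then have "t \<otimes> lincomb G h J c = t' \<otimes> lincomb G h J c" using y cc TG a L by simp
      then have "t = t'" using TG a L by simp
      with cc show "t = t' \<and> c = c'" by simp
    qed
    show "(\<lambda>(t, c). N #> (t \<otimes> lincomb G h J c)) ` (T \<times> C) = TQ"
    proof (intro equalityI subsetI)
      fix Y assume "Y \<in> (\<lambda>(t, c). N #> (t \<otimes> lincomb G h J c)) ` (T \<times> C)"
      then obtain t c where Y: "Y = N #> (t \<otimes> lincomb G h J c)" "t \<in> T" by auto
      have "(t \<otimes> lincomb G h J c) [^] q = lincomb G h J (\<lambda>i. c i * int q)"
        using TG Y(2) L by (simp add: nat_pow_distrib LC)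
      then have "(t \<otimes> lincomb G h J c) [^] q \<in> N" using N by blast
      then show "Y \<in> TQ"
        using Y TG L FactGroup_pow_eq_one_iff[OF sub] by (auto simp: TQ_def carrier_FactGroup)
    next
      fix Y assume "Y \<in> TQ"
      then obtain x where x: "x \<in> carrier G" "Y = N #> x" "x [^] q \<in> N"
        using FactGroup_pow_eq_one_iff[OF sub] by (auto simp: TQ_def carrier_FactGroup)
      then obtain d where d: "x [^] q = lincomb G h J (\<lambda>i. d i * int q)" using N by blast
      \<comment> \<open>Since \<open>x [^] q\<close> is itself the \<open>q\<close>-th power of
        \<open>lincomb G h J d\<close>, dividing \<open>x\<close> by that combination leaves an
        element killed by \<open>q\<close>.\<close>
      define t where "t = x \<otimes> inv (lincomb G h J d)"
      have tG: "t \<in> carrier G" unfolding t_def using x L by simp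
      have "t [^] q = x [^] q \<otimes> inv (lincomb G h J d [^] q)"
        unfolding t_def using x L by (simp add: nat_pow_distrib nat_pow_inv)
      also have "\<dots> = \<one>" unfolding d LC using L by simp
      finally have "t \<in> T" using tG by (simp add: T_def)
      \<comment> \<open>Remainders modulo \<open>q\<close> pick the representative in
        \<open>C\<close>; the quotients contribute an element of \<open>N\<close>.\<close>
      define c where "c = (\<lambda>i\<in>J. d i mod int q)"
      have "c \<in> C" unfolding c_def C_def using q by auto
      have "lincomb G h J d = lincomb G h J (\<lambda>i. (d i div int q) * int q + c i)"
        by (rule lincomb_cong) (use h in \<open>auto simp: c_def\<close>)
      also have "\<dots> = lincomb G h J (\<lambda>i. (d i div int q) * int q) \<otimes> lincomb G h J c"
        by (rule lincomb_add[OF h(1)])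
      finally have dc: "lincomb G h J d = lincomb G h J (\<lambda>i. (d i div int q) * int q) \<otimes> lincomb G h J c" .
      have "x = t \<otimes> lincomb G h J d" unfolding t_def using x L by (simp add: m_assoc)
      also have "\<dots> = lincomb G h J (\<lambda>i. (d i div int q) * int q) \<otimes> (t \<otimes> lincomb G h J c)"
        unfolding dc using tG L by (simp add: m_ac)
      finally have "x = lincomb G h J (\<lambda>i. (d i div int q) * int q) \<otimes> (t \<otimes> lincomb G h J c)" .
      moreover have "lincomb G h J (\<lambda>i. (d i div int q) * int q) \<in> N"
        unfolding N by (intro exI[of _ "\<lambda>i. d i div int q"] refl)
      ultimately have "x \<in> N #> (t \<otimes> lincomb G h J c)" unfolding r_coset_def by auto
      then have "Y = N #> (t \<otimes> lincomb G h J c)"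
        unfolding x(2) using repr_independence[OF _ _ sub] tG L by simp
      then show "Y \<in> (\<lambda>(t, c). N #> (t \<otimes> lincomb G h J c)) ` (T \<times> C)"
        using \<open>t \<in> T\<close> \<open>c \<in> C\<close> by (intro image_eqI[of _ _ "(t, c)"]) auto
    qed
  qed
  have "finite TQ" using finQ by (simp add: TQ_def)
  then have "finite (T \<times> C)" using bij_betw_finite[OF bij2] by simp
  \<comment> \<open>\<open>G\<close> may be infinite, so finiteness of \<open>T\<close> is read off
    from the finite product with \<open>C\<close>, which requires \<open>C\<close> to be
    nonempty.\<close>
  moreover have "(\<lambda>i\<in>J. 0) \<in> C" using q by (auto simp: C_def)
  ultimately show "finite {x \<in> carrier G. x [^] q = \<one>}"
    unfolding T_def[symmetric] by (auto dest: finite_cartesian_productD1)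
  have "card C = q ^ card J" unfolding C_def using h(2) by (simp add: card_PiE)
  then show "card (Hom G (integer_mod_group q)) = q ^ card J * card {x \<in> carrier G. x [^] q = \<one>}"
    using card1 bij_betw_same_card[OF bij2] unfolding T_def[symmetric]
    by (simp add: card_cartesian_product mult.commute)
qed

section \<open>Independence of the rank from the chosen maximal family\<close>

lemma (in comm_group) indep_family_extend_carrier:
  assumes "finite S" "S \<subseteq> carrier G" "generate G S = carrier G" "indep_family G (\<lambda>x. x) I"
  obtains J where "I \<subseteq> J" "indep_family G (\<lambda>x. x) J"
    "\<And>x. x \<in> carrier G \<Longrightarrow> \<exists>n::nat. n > 0 \<and> x [^] n \<in> generate G J"
proof -
  have "(\<lambda>x. x) \<in> I \<union> S \<rightarrow> carrier G" using assms(2,4) by (auto simp: indep_family_def)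
  then obtain J where J: "I \<subseteq> J" "indep_family G (\<lambda>x. x) J"
    "\<forall>k\<in>S. \<exists>n::nat. n > 0 \<and> k [^] n \<in> generate G ((\<lambda>x. x) ` J)"
    using indep_family_extend[OF assms(1) _ assms(4)] by blast
  have "J \<subseteq> carrier G" using J(2) by (auto simp: indep_family_def)
  then have "subgroup (generate G J) G" by (rule generate_is_subgroup)
  from pow_mem_generate_finite_common[OF assms(1,2) this] J(3) assms(3)
  have "\<exists>n::nat. n > 0 \<and> (\<forall>x\<in>carrier G. x [^] n \<in> generate G J)" by simp
  with J that show thesis by blast
qed

(* Taking q = 2 in the count of homomorphisms shows that all maximal independent families
   have the same size. *)
lemma (in comm_group) abelian_rank_eq:
  assumes S: "finite S" "S \<subseteq> carrier G" "generate G S = carrier G" and J: "indep_family G h J"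
    and tors: "\<And>x. x \<in> carrier G \<Longrightarrow> \<exists>n::nat. n > 0 \<and> x [^] n \<in> generate G (h ` J)"
  shows "abelian_rank G = card J"
proof -
  have le: "card I \<le> card J" if I: "int_independent G I" for I
  proof -
    from I have "indep_family G (\<lambda>x. x) I" by (simp add: int_independent_iff_indep_family)
    then obtain K where K: "I \<subseteq> K" "indep_family G (\<lambda>x. x) K"
      "\<And>x. x \<in> carrier G \<Longrightarrow> \<exists>n::nat. n > 0 \<and> x [^] n \<in> generate G K"
      using indep_family_extend_carrier[OF S] by blast
    have fin: "finite {x \<in> carrier G. x [^] (2::nat) = \<one>}"
      using card_Hom_indep_family(2)[OF _ S J tors, of 2] by simp
    have "card (Hom G (integer_mod_group 2)) = 2 ^ card J * card {x \<in> carrier G. x [^] (2::nat) = \<one>}"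
      by (rule card_Hom_indep_family(3)[OF _ S J tors]) simp_all
    moreover have "card (Hom G (integer_mod_group 2)) = 2 ^ card K * card {x \<in> carrier G. x [^] (2::nat) = \<one>}"
      by (rule card_Hom_indep_family(3)[OF _ S K(2)]) (simp_all add: K(3))
    \<comment> \<open>The identity is killed by 2, so the common factor is positive and cancels,
      leaving equal powers of 2.\<close>
    moreover have "card {x \<in> carrier G. x [^] (2::nat) = \<one>} > 0"
      using fin by (auto simp: card_gt_0_iff intro: exI[of _ \<one>])
    ultimately have "card J = card K" by simp
    moreover have "finite K" using K(2) by (simp add: indep_family_def)
    ultimately show ?thesis using K(1) by (simp add: card_mono)
  qed
  have "int_independent G (h ` J)"
    using indep_family_image[OF J] by (simp add: int_independent_iff_indep_family)
  moreover have "card (h ` J) = card J" using card_image[OF indep_family_inj_on[OF J]] .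
  ultimately have "card J \<in> {card S |S. int_independent G S}" by force
  then show ?thesis unfolding abelian_rank_def using le by (intro cSup_eq_maximum) auto
qed

section \<open>Combinations and ranks inside a generated subgroup\<close>

lemma (in comm_group) subgroup_generated_lincomb:
  assumes "h \<in> I \<rightarrow> carrier G" "J \<subseteq> I"
  shows "lincomb (subgroup_generated G (h ` I)) h J c = lincomb G h J c"
proof (cases "finite J")
  case True
  let ?K = "subgroup_generated G (h ` I)"
  interpret K: comm_group ?K by (rule abelian_subgroup_generated) (rule comm_group_axioms)
  have K: "h i \<in> carrier ?K" if "i \<in> I" for i
    unfolding carrier_subgroup_generated using that assms(1) by (intro generate.incl) auto
  from True assms(2) show ?thesis
  proof (induction J)
    case empty
    then show ?case by (simp add: lincomb_def)
  next
    case (insert j J)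
    then have "h \<in> insert j J \<rightarrow> carrier ?K" "h \<in> insert j J \<rightarrow> carrier G"
      using K assms(1) by auto
    with insert show ?case
      by (simp add: lincomb_insert K.lincomb_insert int_pow_subgroup_generated K)
  qed
\<comment> \<open>For infinite \<open>J\<close> both products take the default value, the common
  identity.\<close>
qed (simp add: lincomb_def finprod_def)

lemma (in comm_group) generate_subgroup_generated_self:
  assumes "Y \<subseteq> carrier G"
  shows "generate (subgroup_generated G Y) Y = carrier (subgroup_generated G Y)" "Y \<subseteq> carrier (subgroup_generated G Y)"
proof -
  show Y: "Y \<subseteq> carrier (subgroup_generated G Y)"
    using assms by (rule subgroup_generated_subset_carrier_subset)
  have "carrier (subgroup_generated (subgroup_generated G Y) Y) = generate (subgroup_generated G Y) Y"
    unfolding carrier_subgroup_generated[of "subgroup_generated G Y"] using Y by (simp add: Int_absorb1)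
  then show "generate (subgroup_generated G Y) Y = carrier (subgroup_generated G Y)" by simp
qed

text \<open>Combinations, powers and spans of \<open>J\<close> are the same in the subgroup as in
  \<open>G\<close>, so \<open>abelian_rank_eq\<close> can be applied inside the subgroup.\<close>

lemma (in comm_group) abelian_rank_subgroup_generated:
  assumes "finite I" "h \<in> I \<rightarrow> carrier G" "J \<subseteq> I" "indep_family G h J"
    and tors: "\<And>i. i \<in> I \<Longrightarrow> \<exists>n::nat. n > 0 \<and> h i [^] n \<in> generate G (h ` J)"
  shows "abelian_rank (subgroup_generated G (h ` I)) = card J"
proof -
  let ?K = "subgroup_generated G (h ` I)"
  interpret K: comm_group ?K by (rule abelian_subgroup_generated) (rule comm_group_axioms)
  have hI: "h ` I \<subseteq> carrier G" using assms(2) by auto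
  note gen = generate_subgroup_generated_self[OF hI]
  have finJ: "finite J" using assms(1,3) finite_subset by auto
  have hJ: "h \<in> J \<rightarrow> carrier ?K" "h \<in> J \<rightarrow> carrier G" using gen(2) assms(2,3) by auto
  have lin: "lincomb ?K h J c = lincomb G h J c" for c
    using subgroup_generated_lincomb[OF assms(2,3)] .
  have genJ: "generate ?K (h ` J) = generate G (h ` J)"
    unfolding generate_eq_lincomb[OF finJ hJ(2)] K.generate_eq_lincomb[OF finJ hJ(1)] lin ..
  have indep: "indep_family ?K h J"
    using assms(4) hJ unfolding indep_family_def by (simp add: lin)
  have sub: "subgroup (generate G (h ` J)) ?K"
    unfolding genJ[symmetric] using hJ by (intro K.generate_is_subgroup) auto
  have "\<exists>n::nat. n > 0 \<and> (\<forall>x\<in>generate ?K (h ` I). x [^]\<^bsub>?K\<^esub> n \<in> generate G (h ` J))"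
    by (rule K.pow_mem_generate_finite_common)
      (use assms(1) gen(2) sub tors in \<open>auto simp: pow_subgroup_generated\<close>)
  then have "\<exists>n::nat. n > 0 \<and> x [^]\<^bsub>?K\<^esub> n \<in> generate ?K (h ` J)" if "x \<in> carrier ?K" for x
    using that gen(1) genJ by auto
  then show ?thesis
    by (intro K.abelian_rank_eq[OF _ gen(2,1) indep]) (use assms(1) in auto)
qed

lemma (in comm_group) card_Hom_finitely_generated:
  assumes S: "finite S" "S \<subseteq> carrier G" "generate G S = carrier G"
  shows "q > 0 \<Longrightarrow> finite (Hom G (integer_mod_group q))"
    and "q > 0 \<Longrightarrow> card (Hom G (integer_mod_group q)) = q ^ abelian_rank G * card {x \<in> carrier G. x [^] q = \<one>}"
    and "finite (torsion_elements G)"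
proof -
  have "indep_family G (\<lambda>x. x) {}" by (simp add: indep_family_def)
  then obtain J where J: "indep_family G (\<lambda>x. x) J"
    and tors: "\<And>x. x \<in> carrier G \<Longrightarrow> \<exists>n::nat. n > 0 \<and> x [^] n \<in> generate G ((\<lambda>x. x) ` J)"
    using indep_family_extend_carrier[OF S] by (metis image_ident)
  have JG: "(\<lambda>x. x) ` J \<subseteq> carrier G" "finite J" using J by (auto simp: indep_family_def)
  have rank: "abelian_rank G = card J" by (rule abelian_rank_eq[OF S J tors])
  show "finite (Hom G (integer_mod_group q))" if "q > 0"
    by (rule card_Hom_indep_family(1)[OF that S J tors])
  show "card (Hom G (integer_mod_group q)) = q ^ abelian_rank G * card {x \<in> carrier G. x [^] q = \<one>}" if "q > 0"
    unfolding rank by (rule card_Hom_indep_family(3)[OF that S J tors])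
  have sub: "subgroup (generate G ((\<lambda>x. x) ` J)) G" using JG(1) by (rule generate_is_subgroup)
  obtain m where m: "m > (0::nat)" "\<And>x. x \<in> carrier G \<Longrightarrow> x [^] m \<in> generate G ((\<lambda>x. x) ` J)"
    using pow_mem_generate_finite_common[OF S(1,2) sub] tors S(2,3) by blast
  \<comment> \<open>The power \<open>m\<close> sends a torsion element to a torsion element of the
    free span, that is, to the identity. The count with \<open>m\<close> in place of
    \<open>q\<close> then shows that there are only finitely many.\<close>
  have "torsion_elements G \<subseteq> {x \<in> carrier G. x [^] m = \<one>}"
  proof
    fix x assume "x \<in> torsion_elements G"
    then obtain n where x: "x \<in> carrier G" "n > (0::nat)" "x [^] n = \<one>" by (auto simp: torsion_elements_def)
    have h: "(\<lambda>x. x) \<in> J \<rightarrow> carrier G" using JG by auto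
    obtain c where c: "x [^] m = lincomb G (\<lambda>x. x) J c"
      using m(2)[OF x(1)] generate_eq_lincomb[OF JG(2) h] by auto
    have "(x [^] m) [^] n = (x [^] n) [^] m" using x(1) by (simp add: nat_pow_pow mult.commute)
    \<comment> \<open>The empty family spans the trivial group; in this reading, torsion-freeness of
      the span is the case of an empty subfamily in
      \<open>indep_family_pow_mem_generate\<close>.\<close>
    then have one: "lincomb G (\<lambda>x. x) J c [^] n \<in> generate G ((\<lambda>x. x) ` {})"
      using x(3) by (simp add: c generate.one)
    have zero: "c i = 0" if "i \<in> J" for i
      using indep_family_pow_mem_generate[OF J _ one x(2) that] by simp
    have "x [^] m = lincomb G (\<lambda>x. x) J (\<lambda>_. 0)"
      unfolding c by (rule lincomb_cong[OF h]) (auto simp: zero)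
    then show "x \<in> {x \<in> carrier G. x [^] m = \<one>}" using x(1) lincomb_zero[OF h] by simp
  qed
  then show "finite (torsion_elements G)"
    using card_Hom_indep_family(2)[OF m(1) S J tors] by (rule finite_subset)
qed

text \<open>The elements killed by \<open>q\<close> lie in the finite torsion subgroup, so equal
  cardinality forces equal sets.\<close>

lemma (in comm_group) card_Hom_eq_torsion_iff:
  assumes S: "finite S" "S \<subseteq> carrier G" "generate G S = carrier G" and q: "q > 0"
  shows "card (Hom G (integer_mod_group q)) = q ^ abelian_rank G * card (torsion_elements G)
    \<longleftrightarrow> (\<forall>x\<in>torsion_elements G. x [^] q = \<one>)"
proof -
  note fin = card_Hom_finitely_generated(3)[OF S]
  have sub: "{x \<in> carrier G. x [^] q = \<one>} \<subseteq> torsion_elements G"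
    using q by (auto simp: torsion_elements_def)
  have "card (Hom G (integer_mod_group q)) = q ^ abelian_rank G * card (torsion_elements G)
    \<longleftrightarrow> card {x \<in> carrier G. x [^] q = \<one>} = card (torsion_elements G)"
    using card_Hom_finitely_generated(2)[OF S q] q by simp
  also have "\<dots> \<longleftrightarrow> {x \<in> carrier G. x [^] q = \<one>} = torsion_elements G"
    using card_subset_eq[OF fin sub] by auto
  also have "\<dots> \<longleftrightarrow> (\<forall>x\<in>torsion_elements G. x [^] q = \<one>)"
    using sub by (auto simp: torsion_elements_def)
  finally show ?thesis .
qed

subsection \<open>Ranks of quotients\<close>

lemma (in group_hom) lincomb_hom:
  assumes "comm_group G" "comm_group H" "f \<in> I \<rightarrow> carrier G"
  shows "h (lincomb G f I c) = lincomb H (h \<circ> f) I c"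
proof (cases "finite I")
  case True
  interpret G: comm_group G by fact
  interpret H: comm_group H by fact
  from True assms(3) show ?thesis
  proof (induction I)
    case empty
    then show ?case by (simp add: lincomb_def)
  next
    case (insert i I)
    then have fI: "f \<in> insert i I \<rightarrow> carrier G" "f \<in> I \<rightarrow> carrier G" "f i \<in> carrier G"
      and hf: "h \<circ> f \<in> insert i I \<rightarrow> carrier H" by (auto simp: Pi_iff)
    show ?case
      unfolding G.lincomb_insert[OF insert.hyps fI(1)] H.lincomb_insert[OF insert.hyps hf]
      using insert.IH fI by (simp add: hom_int_pow o_def)
  qed
qed (simp add: lincomb_def finprod_def)

lemma (in comm_group) group_hom_FactGroup:
  assumes "subgroup N G"
  shows "group_hom G (G Mod N) (\<lambda>x. N #> x)"
  using normal.r_coset_hom_Mod[OF subgroup_imp_normal[OF assms]]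
    normal.factorgroup_is_group[OF subgroup_imp_normal[OF assms]] is_group
  by (simp add: group_hom_def group_hom_axioms_def)

lemma (in comm_group) FactGroup_generate:
  assumes "subgroup N G" "S \<subseteq> carrier G" "generate G S = carrier G"
  shows "(\<lambda>x. N #> x) ` S \<subseteq> carrier (G Mod N)"
    "generate (G Mod N) ((\<lambda>x. N #> x) ` S) = carrier (G Mod N)"
  using group_hom.generate_img[OF group_hom_FactGroup[OF assms(1)] assms(2)] assms(2,3)
  by (auto simp: carrier_FactGroup)

text \<open>Take a maximal independent set \<open>K\<close> from the given family and extend it to a
  maximal independent set \<open>L\<close> of \<open>G\<close>. The cosets of \<open>L - K\<close>
  form a maximal independent family of the quotient: a combination lying in \<open>N\<close> has a
  power in the span of \<open>K\<close>, so its coefficients vanish, and the elements of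
  \<open>K\<close> become trivial.\<close>

lemma (in comm_group) abelian_rank_FactGroup:
  assumes S: "finite S" "S \<subseteq> carrier G" "generate G S = carrier G"
    and I: "finite I" "h \<in> I \<rightarrow> carrier G"
  shows "abelian_rank G = abelian_rank (subgroup_generated G (h ` I)) + abelian_rank (G Mod generate G (h ` I))"
proof -
  define N where "N = generate G (h ` I)"
  have hI: "h ` I \<subseteq> carrier G" using I by auto
  have sub: "subgroup N G" unfolding N_def using hI by (rule generate_is_subgroup)
  interpret N: normal N G using sub by (rule subgroup_imp_normal)
  interpret Q: comm_group "G Mod N" using sub by (rule abelian_FactGroup)
  interpret p: group_hom G "G Mod N" "\<lambda>x. N #> x" by (rule group_hom_FactGroup[OF sub])
  have "indep_family G h {}" by (simp add: indep_family_def)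
  then obtain J where J: "J \<subseteq> I" "indep_family G h J"
    "\<And>i. i \<in> I \<Longrightarrow> \<exists>n::nat. n > 0 \<and> h i [^] n \<in> generate G (h ` J)"
    using indep_family_extend[of I h "{}"] I by auto
  have rank1: "abelian_rank (subgroup_generated G (h ` I)) = card J"
    by (rule abelian_rank_subgroup_generated[OF I J])
  \<comment> \<open>The index family is replaced by its set of values, since the extension adds
    elements of \<open>G\<close> that have no index in \<open>I\<close>.\<close>
  define K where "K = h ` J"
  have indK: "indep_family G (\<lambda>x. x) K" unfolding K_def by (rule indep_family_image[OF J(2)])
  have cardK: "card K = card J" unfolding K_def by (rule card_image[OF indep_family_inj_on[OF J(2)]])
  have KN: "K \<subseteq> N" unfolding K_def N_def using J(1) by (auto intro: generate.incl)
  have KG: "K \<subseteq> carrier G" "finite K" using indK by (auto simp: indep_family_def)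
  obtain L where L: "K \<subseteq> L" "indep_family G (\<lambda>x. x) L"
    "\<And>x. x \<in> carrier G \<Longrightarrow> \<exists>n::nat. n > 0 \<and> x [^] n \<in> generate G L"
    using indep_family_extend_carrier[OF S indK] by blast
  have LG: "L \<subseteq> carrier G" "finite L" using L(2) by (auto simp: indep_family_def)
  have rank: "abelian_rank G = card L"
    by (rule abelian_rank_eq[OF S L(2)]) (simp add: L(3))
  obtain m where m: "m > (0::nat)" "\<And>x. x \<in> N \<Longrightarrow> x [^] m \<in> generate G K"
  proof -
    have "subgroup (generate G K) G" using KG(1) by (rule generate_is_subgroup)
    then have "\<exists>n::nat. n > 0 \<and> (\<forall>x\<in>generate G (h ` I). x [^] n \<in> generate G K)"
      by (rule pow_mem_generate_finite_common[rotated 2]) (use I hI J(3) in \<open>auto simp: K_def\<close>)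
    with that show thesis unfolding N_def by blast
  qed
  have DG: "(\<lambda>x. x) \<in> L - K \<rightarrow> carrier G" "(\<lambda>x. N #> x) \<in> L - K \<rightarrow> carrier (G Mod N)"
    using LG by (auto simp: carrier_FactGroup)
  have indD: "indep_family (G Mod N) (\<lambda>x. N #> x) (L - K)"
  proof (rule indep_familyI)
    show "finite (L - K)" using LG by simp
    show "(\<lambda>x. N #> x) \<in> L - K \<rightarrow> carrier (G Mod N)" by (rule DG(2))
    fix c y assume c: "lincomb (G Mod N) (\<lambda>x. N #> x) (L - K) c = \<one>\<^bsub>G Mod N\<^esub>" and y: "y \<in> L - K"
    define z where "z = lincomb G (\<lambda>x. x) (L - K) c"
    have z: "z \<in> carrier G" unfolding z_def using DG(1) by (rule lincomb_closed)
    have "N #> z = N"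
      using p.lincomb_hom[OF comm_group_axioms Q.comm_group_axioms DG(1), of c] c unfolding z_def by (simp add: o_def)
    then have "z \<in> N" using coset_join1[OF _ z sub] by blast
    then have "z [^] m \<in> generate G K" by (rule m(2))
    moreover have "z = lincomb G (\<lambda>x. x) L (\<lambda>x. if x \<in> L - K then c x else 0)"
      unfolding z_def using LG by (intro lincomb_extend) auto
    ultimately have "lincomb G (\<lambda>x. x) L (\<lambda>x. if x \<in> L - K then c x else 0) [^] m \<in> generate G ((\<lambda>x. x) ` K)"
      by simp
    from indep_family_pow_mem_generate[OF L(2,1) this m(1), of y] y show "c y = 0" by simp
  qed
  have "generate (G Mod N) ((\<lambda>x. N #> x) ` L) \<subseteq> generate (G Mod N) ((\<lambda>x. N #> x) ` (L - K))"
  proof (rule Q.generate_subgroup_incl)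
    show subD: "subgroup (generate (G Mod N) ((\<lambda>x. N #> x) ` (L - K))) (G Mod N)"
      using DG(2) by (intro Q.generate_is_subgroup) auto
    show "(\<lambda>x. N #> x) ` L \<subseteq> generate (G Mod N) ((\<lambda>x. N #> x) ` (L - K))"
    proof (rule image_subsetI)
      fix x assume x: "x \<in> L"
      show "N #> x \<in> generate (G Mod N) ((\<lambda>x. N #> x) ` (L - K))"
      proof (cases "x \<in> K")
        case True
        then have "N #> x = \<one>\<^bsub>G Mod N\<^esub>" using KN N.rcos_const[OF is_group] by auto
        then show ?thesis by (simp only: generate.one)
      next
        case False
        with x show ?thesis by (auto intro: generate.incl)
      qed
    qed
  qed
  then have genL: "(\<lambda>x. N #> x) ` generate G L \<subseteq> generate (G Mod N) ((\<lambda>x. N #> x) ` (L - K))"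
    using p.generate_img[OF LG(1)] by simp
  have "abelian_rank (G Mod N) = card (L - K)"
  proof (rule Q.abelian_rank_eq[OF _ FactGroup_generate[OF sub S(2,3)] indD])
    show "finite ((\<lambda>x. N #> x) ` S)" using S(1) by simp
    fix y assume "y \<in> carrier (G Mod N)"
    then obtain x where x: "x \<in> carrier G" "y = N #> x" by (auto simp: carrier_FactGroup)
    then obtain n where n: "n > (0::nat)" "x [^] n \<in> generate G L" using L(3) by blast
    have "y [^]\<^bsub>G Mod N\<^esub> n = N #> (x [^] n)" using x N.FactGroup_pow by metis
    with n genL show "\<exists>n::nat. n > 0 \<and> y [^]\<^bsub>G Mod N\<^esub> n \<in> generate (G Mod N) ((\<lambda>x. N #> x) ` (L - K))"
      by auto
  qed
  then show ?thesis
    using rank rank1 cardK card_Diff_subset[OF KG(2) L(1)] card_mono[OF LG(2) L(1)] unfolding N_def by simp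
qed

subsection \<open>Bases of the arithmetic matroid\<close>

text \<open>The rank is the size of any maximal independent subfamily \<open>J\<close>, and a subset
  of the same finite size as \<open>I\<close> is \<open>I\<close> itself. This identifies the bases
  of the rank function with maximal independent families.\<close>

lemma (in comm_group) list_rank_eq_card_iff:
  assumes "finite I" "h \<in> I \<rightarrow> carrier G"
  shows "list_rank G h I = card I \<longleftrightarrow> indep_family G h I"
proof
  assume indep: "indep_family G h I"
  have "\<exists>n::nat. n > 0 \<and> h i [^] n \<in> generate G (h ` I)" if "i \<in> I" for i
    using that assms(2) by (intro exI[of _ 1]) (auto simp: Pi_iff intro: generate.incl)
  then show "list_rank G h I = card I"
    unfolding list_rank_def by (intro abelian_rank_subgroup_generated[OF assms order_refl indep]) auto
next
  assume rank: "list_rank G h I = card I"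
  have "indep_family G h {}" by (simp add: indep_family_def)
  then obtain J where J: "J \<subseteq> I" "indep_family G h J"
    "\<And>i. i \<in> I \<Longrightarrow> \<exists>n::nat. n > 0 \<and> h i [^] n \<in> generate G (h ` J)"
    using indep_family_extend[of I h "{}"] assms by auto
  then have "card J = card I"
    using abelian_rank_subgroup_generated[OF assms J] rank unfolding list_rank_def by simp
  then have "J = I" using card_subset_eq[OF assms(1) J(1)] by simp
  with J(2) show "indep_family G h I" by simp
qed

lemma (in comm_group) list_bases_iff:
  assumes "finite E" "h \<in> E \<rightarrow> carrier G"
  shows "B \<in> list_bases G E h \<longleftrightarrow> B \<subseteq> E \<and> indep_family G h B \<and>
    (\<forall>C. B \<subseteq> C \<and> C \<subseteq> E \<and> indep_family G h C \<longrightarrow> C = B)"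
proof -
  have "list_rank G h C = card C \<longleftrightarrow> indep_family G h C" if "C \<subseteq> E" for C
    using list_rank_eq_card_iff[of C h] that assms finite_subset by auto
  then show ?thesis unfolding list_bases_def matroid_bases_def by blast
qed

text \<open>A family whose span contains a power of each \<open>h e\<close> is a basis: in a larger
  independent family, the coefficient 1 of an additional \<open>h e\<close> would have to
  vanish.\<close>

lemma (in comm_group) indep_family_extend_basis:
  assumes E: "finite E" "h \<in> E \<rightarrow> carrier G" and I: "I \<subseteq> E" "indep_family G h I"
  obtains B where "I \<subseteq> B" "B \<in> list_bases G E h"
proof -
  have "h \<in> I \<union> E \<rightarrow> carrier G" using E I by auto
  then obtain B where B: "I \<subseteq> B" "B \<subseteq> E" "indep_family G h B"
    and gen: "\<And>e. e \<in> E \<Longrightarrow> \<exists>n::nat. n > 0 \<and> h e [^] n \<in> generate G (h ` B)"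
    using indep_family_extend[OF E(1) _ I(2)] I(1) by (metis Un_absorb1)
  have "C = B" if C: "B \<subseteq> C" "C \<subseteq> E" "indep_family G h C" for C
  proof (rule ccontr)
    assume "C \<noteq> B"
    then obtain e where e: "e \<in> C" "e \<notin> B" using C by auto
    then obtain n where n: "n > (0::nat)" "h e [^] n \<in> generate G (h ` B)" using gen C by blast
    have hC: "finite C" "h \<in> C \<rightarrow> carrier G" using C(3) by (auto simp: indep_family_def)
    have "h e = lincomb G h C (\<lambda>j. if j = e then 1 else 0)"
      using lincomb_unit[OF hC e(1), of 1] hC e(1) by (simp add: Pi_iff)
    with n have "lincomb G h C (\<lambda>j. if j = e then 1 else 0) [^] n \<in> generate G (h ` B)" by simp
    from indep_family_pow_mem_generate[OF C(3,1) this n(1) e] show False by simp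
  qed
  then have "B \<in> list_bases G E h" using B unfolding list_bases_iff[OF E] by blast
  with B(1) that show thesis by blast
qed

text \<open>Moves the condition from cosets to representatives, so that conditions for different
  subgroups can be compared within \<open>G\<close>.\<close>

lemma (in comm_group) torsion_exponent_iff:
  assumes "subgroup N G"
  shows "(\<forall>x\<in>torsion_elements (G Mod N). x [^]\<^bsub>G Mod N\<^esub> q = \<one>\<^bsub>G Mod N\<^esub>) \<longleftrightarrow>
    (\<forall>x\<in>carrier G. \<forall>n::nat. n > 0 \<longrightarrow> x [^] n \<in> N \<longrightarrow> x [^] (q::nat) \<in> N)"
proof -
  note pow = FactGroup_pow_eq_one_iff[OF assms]
  have "torsion_elements (G Mod N) = (\<lambda>x. N #> x) ` {x \<in> carrier G. \<exists>n::nat. n > 0 \<and> x [^] n \<in> N}"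
    unfolding torsion_elements_def carrier_FactGroup using pow by blast
  then show ?thesis by (simp add: pow del: one_FactGroup) blast
qed

text \<open>The polynomial identity yields a condition for each \<open>A\<close>, whereas
  \<open>Z_A\<close> speaks of bases only; this closes the gap.\<close>

lemma (in comm_group) Z_A_iff:
  assumes E: "finite E" "h \<in> E \<rightarrow> carrier G"
  shows "q \<in> Z_A G E h \<longleftrightarrow> q > 0 \<and>
    (\<forall>A\<subseteq>E. \<forall>x\<in>torsion_elements (quot G h A). x [^]\<^bsub>quot G h A\<^esub> q = \<one>\<^bsub>quot G h A\<^esub>)"
proof
  assume q: "q \<in> Z_A G E h"
  have sub: "subgroup (generate G (h ` A)) G" if "A \<subseteq> E" for A
    using that E(2) by (intro generate_is_subgroup) auto
  have "\<forall>x\<in>torsion_elements (quot G h A). x [^]\<^bsub>quot G h A\<^esub> q = \<one>\<^bsub>quot G h A\<^esub>" if A: "A \<subseteq> E" for A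
    unfolding quot_def torsion_exponent_iff[OF sub[OF A]]
  proof (intro ballI allI impI)
    fix x and n :: nat assume x: "x \<in> carrier G" "n > 0" "x [^] n \<in> generate G (h ` A)"
    have hA: "h \<in> A \<rightarrow> carrier G" "finite A" using A E finite_subset by auto
    have "indep_family G h {}" by (simp add: indep_family_def)
    then obtain I where I: "I \<subseteq> A" "indep_family G h I"
      "\<And>a. a \<in> A \<Longrightarrow> \<exists>n::nat. n > 0 \<and> h a [^] n \<in> generate G (h ` I)"
      using indep_family_extend[of A h "{}"] hA by auto
    have IE: "I \<subseteq> E" using I(1) A by auto
    obtain m where m: "m > (0::nat)" "\<And>y. y \<in> generate G (h ` A) \<Longrightarrow> y [^] m \<in> generate G (h ` I)"
    proof -
      have "\<exists>n::nat. n > 0 \<and> (\<forall>x\<in>generate G (h ` A). x [^] n \<in> generate G (h ` I))"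
        using sub[OF IE] by (rule pow_mem_generate_finite_common[rotated 2]) (use hA I(3) in auto)
      with that show thesis by blast
    qed
    obtain B where B: "I \<subseteq> B" "B \<in> list_bases G E h"
      using indep_family_extend_basis[OF E IE I(2)] by blast
    then have BE: "B \<subseteq> E" "indep_family G h B" unfolding list_bases_iff[OF E] by auto
    have hB: "finite B" "h \<in> B \<rightarrow> carrier G" using BE(2) by (auto simp: indep_family_def)
    have hI: "h \<in> I \<rightarrow> carrier G" using hA I(1) by auto
    \<comment> \<open>The exponent \<open>n\<close> leads into the span of \<open>A\<close> and
      \<open>m\<close> onward into that of \<open>I\<close>, which the span of \<open>B\<close>
      contains. So \<open>x\<close> is torsion modulo the span of \<open>B\<close> and the
      hypothesis on the basis applies.\<close>
    have nm: "x [^] (n * m) \<in> generate G (h ` I)"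
      using m(2)[OF x(3)] x(1) by (simp add: nat_pow_pow)
    have "generate G (h ` I) \<subseteq> generate G (h ` B)" using B(1) by (intro mono_generate) auto
    moreover have "\<forall>y\<in>carrier G. \<forall>n::nat. n > 0 \<longrightarrow> y [^] n \<in> generate G (h ` B) \<longrightarrow> y [^] q \<in> generate G (h ` B)"
      using q B(2) torsion_exponent_iff[OF sub[OF BE(1)], of q] unfolding Z_A_def quot_def by blast
    ultimately have "x [^] q \<in> generate G (h ` B)" using nm x(1,2) m(1) by (metis nat_0_less_mult_iff subsetD)
    then obtain c where c: "x [^] q = lincomb G h B c" using generate_eq_lincomb[OF hB] by auto
    \<comment> \<open>Exchanging the exponents shows that \<open>x [^] q\<close>, now known as a
      combination over \<open>B\<close>, has a power in the span of \<open>I\<close>; its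
      coefficients outside \<open>I\<close> are therefore zero.\<close>
    have "(x [^] q) [^] (n * m) = (x [^] (n * m)) [^] q"
      using x(1) by (simp add: nat_pow_pow mult.commute mult.left_commute)
    also have "\<dots> \<in> generate G (h ` I)"
      using subgroup_int_pow_closed[OF sub[OF IE] nm, of "int q"] by (simp add: int_pow_int)
    finally have "lincomb G h B c [^] (n * m) \<in> generate G (h ` I)" unfolding c .
    then have "c b = 0" if "b \<in> B - I" for b
      using indep_family_pow_mem_generate[OF BE(2) B(1)] x(2) m(1) that by auto
    then have "x [^] q = lincomb G h I c"
      unfolding c by (intro lincomb_mono_neutral[OF hB(1) B(1) hB(2), symmetric]) auto
    then have "x [^] q \<in> generate G (h ` I)"
      using generate_eq_lincomb[OF finite_subset[OF B(1) hB(1)] hI] by auto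
    then show "x [^] q \<in> generate G (h ` A)"
      using mono_generate[of "h ` I" "h ` A"] I(1) by blast
  qed
  with q show "q > 0 \<and> (\<forall>A\<subseteq>E. \<forall>x\<in>torsion_elements (quot G h A). x [^]\<^bsub>quot G h A\<^esub> q = \<one>\<^bsub>quot G h A\<^esub>)"
    by (simp add: Z_A_def)
next
  assume "q > 0 \<and> (\<forall>A\<subseteq>E. \<forall>x\<in>torsion_elements (quot G h A). x [^]\<^bsub>quot G h A\<^esub> q = \<one>\<^bsub>quot G h A\<^esub>)"
  moreover have "B \<subseteq> E" if "B \<in> list_bases G E h" for B
    using that by (simp add: list_bases_def matroid_bases_def)
  ultimately show "q \<in> Z_A G E h" unfolding Z_A_def by blast
qed

text \<open>The kernel is a subgroup, so vanishing on \<open>Y\<close> is vanishing on the subgroup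
  it generates, and such homomorphisms are those of the quotient.\<close>

lemma (in comm_group) card_Hom_vanishing:
  assumes "Y \<subseteq> carrier G"
  shows "card {\<phi> \<in> Hom G (integer_mod_group q). \<forall>x\<in>Y. \<phi> x = 0} = card (Hom (G Mod generate G Y) (integer_mod_group q))"
proof -
  have sub: "subgroup (generate G Y) G" using assms by (rule generate_is_subgroup)
  have "(\<forall>x\<in>generate G Y. \<phi> x = 0) \<longleftrightarrow> (\<forall>x\<in>Y. \<phi> x = 0)" if \<phi>: "\<phi> \<in> Hom G (integer_mod_group q)" for \<phi>
  proof
    have "group_hom G (integer_mod_group q) \<phi>"
      using \<phi> is_group by (simp add: group_hom_def group_hom_axioms_def Hom_def)
    then have "subgroup (kernel G (integer_mod_group q) \<phi>) G" by (rule group_hom.subgroup_kernel)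
    moreover assume "\<forall>x\<in>Y. \<phi> x = 0"
    then have "Y \<subseteq> kernel G (integer_mod_group q) \<phi>" using assms by (auto simp: kernel_def)
    ultimately have "generate G Y \<subseteq> kernel G (integer_mod_group q) \<phi>" by (intro generate_subgroup_incl)
    then show "\<forall>x\<in>generate G Y. \<phi> x = 0" by (auto simp: kernel_def)
  qed (auto intro: generate.incl)
  then have "{\<phi> \<in> Hom G (integer_mod_group q). \<forall>x\<in>Y. \<phi> x = 0} =
      {\<phi> \<in> Hom G (integer_mod_group q). \<forall>x\<in>generate G Y. \<phi> x = \<one>\<^bsub>integer_mod_group q\<^esub>}" by auto
  then show ?thesis
    using bij_betw_same_card[OF normal.bij_betw_Hom_FactGroup[OF subgroup_imp_normal[OF sub] group_integer_mod_group[of q]]]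
    by simp
qed

subsection \<open>Comparing coefficients\<close>

text \<open>The exponent vector of the monomial v_A, that is, the indicator function of
  \<open>A\<close>.\<close>

definition squarefree_monomial :: "'e set \<Rightarrow> 'e \<Rightarrow>\<^sub>0 nat" where
  "squarefree_monomial A = (\<Sum>e\<in>A. Poly_Mapping.single e 1)"

lemma lookup_squarefree_monomial:
  assumes "finite A"
  shows "Poly_Mapping.lookup (squarefree_monomial A) e = (if e \<in> A then 1 else 0)"
  unfolding squarefree_monomial_def lookup_sum using assms by (simp add: lookup_single when_def)

lemma inj_on_squarefree_monomial: "inj_on squarefree_monomial {A. finite A}"
proof (rule inj_onI)
  fix A B :: "'a set"
  assume A: "A \<in> {A. finite A}" and B: "B \<in> {A. finite A}"
    and eq: "squarefree_monomial A = squarefree_monomial B"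
  have "e \<in> A \<longleftrightarrow> e \<in> B" for e
  proof -
    have fin: "finite A" "finite B" using A B by simp_all
    have "(if e \<in> A then 1 else (0::nat)) = Poly_Mapping.lookup (squarefree_monomial A) e"
      by (rule lookup_squarefree_monomial[OF fin(1), symmetric])
    also have "\<dots> = (if e \<in> B then 1 else 0)"
      unfolding eq by (rule lookup_squarefree_monomial[OF fin(2)])
    finally show ?thesis by (cases "e \<in> A"; cases "e \<in> B") simp_all
  qed
  then show "A = B" by blast
qed

lemma prod_mpoly_var: "finite A \<Longrightarrow> (\<Prod>e\<in>A. mpoly_var e) = Poly_Mapping.single (squarefree_monomial A) 1"
  by (induction A rule: finite_induct) (simp_all add: squarefree_monomial_def mpoly_var_def mult_single)

text \<open>Distinct subsets have distinct monomials, so each coefficient can be read off.\<close>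

lemma sum_squarefree_eq_iff:
  fixes a b :: "'e set \<Rightarrow> rat"
  assumes "finite E"
  shows "(\<Sum>A\<in>Pow E. Poly_Mapping.single (squarefree_monomial A) (a A)) =
      (\<Sum>A\<in>Pow E. Poly_Mapping.single (squarefree_monomial A) (b A)) \<longleftrightarrow> (\<forall>A\<subseteq>E. a A = b A)"
    (is "?l a = ?l b \<longleftrightarrow> _")
proof
  have coeff: "Poly_Mapping.lookup (?l c) (squarefree_monomial B) = c B" if B: "B \<subseteq> E" for c :: "'e set \<Rightarrow> rat" and B
  proof -
    have "squarefree_monomial A = squarefree_monomial B \<longleftrightarrow> A = B" if "A \<in> Pow E" for A
      using inj_onD[OF inj_on_squarefree_monomial, of A B] that B assms finite_subset by auto
    then have "Poly_Mapping.lookup (?l c) (squarefree_monomial B) = (\<Sum>A\<in>Pow E. if A = B then c A else 0)"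
      unfolding lookup_sum lookup_single by (intro sum.cong) (auto simp: when_def)
    then show ?thesis using B assms by simp
  qed
  assume "?l a = ?l b"
  then show "\<forall>A\<subseteq>E. a A = b A" using coeff by metis
next
  assume "\<forall>A\<subseteq>E. a A = b A"
  then show "?l a = ?l b" by (intro sum.cong) auto
qed

text \<open>Multiplying out gives one term for each \<open>A\<close>, where the product of Kronecker
  deltas is 1 or 0 according to whether \<phi> kills all \<open>g e\<close> with \<open>e\<close> in
  \<open>A\<close>. Interchanging the sums counts these \<phi>.\<close>

lemma Z_potts_expansion:
  fixes G :: "('a, 'b) monoid_scheme" and g :: "'e \<Rightarrow> 'a"
  assumes "finite E" "finite (Hom G (integer_mod_group q))"
  shows "Z_potts G E g q = (\<Sum>A\<in>Pow E. Poly_Mapping.single (squarefree_monomial A)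
      (of_nat (card {\<phi> \<in> Hom G (integer_mod_group q). \<forall>x\<in>g ` A. \<phi> x = 0})))"
proof -
  let ?H = "Hom G (integer_mod_group q)"
  have prod: "(\<Prod>e\<in>A. mpoly_var e * (if \<phi> (g e) = \<one>\<^bsub>integer_mod_group q\<^esub> then 1 else 0)) =
      (if \<forall>x\<in>g ` A. \<phi> x = 0 then Poly_Mapping.single (squarefree_monomial A) (1::rat) else 0)"
    if A: "finite A" for A and \<phi> :: "'a \<Rightarrow> int"
  proof (cases "\<forall>x\<in>g ` A. \<phi> x = 0")
    case True
    then show ?thesis using prod_mpoly_var[OF A] by simp
  next
    case False
    then obtain e where "e \<in> A" "\<phi> (g e) \<noteq> 0" by blast
    then show ?thesis using A False by (subst prod_zero[OF A]) (auto intro!: bexI[of _ e])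
  qed
  have "Z_potts G E g q = (\<Sum>\<phi>\<in>?H. \<Sum>A\<in>Pow E.
      (if \<forall>x\<in>g ` A. \<phi> x = 0 then Poly_Mapping.single (squarefree_monomial A) 1 else 0))"
    unfolding Z_potts_def
  proof (intro sum.cong refl)
    fix \<phi> :: "'a \<Rightarrow> int"
    \<comment> \<open>The order of the summands matters for \<open>prod_add\<close>:
      \<open>A\<close> is to be the set of factors in which the variable is chosen.\<close>
    have "(\<Prod>e\<in>E. 1 + mpoly_var e * (if \<phi> (g e) = \<one>\<^bsub>integer_mod_group q\<^esub> then 1 else 0)) =
       (\<Prod>e\<in>E. mpoly_var e * (if \<phi> (g e) = \<one>\<^bsub>integer_mod_group q\<^esub> then 1 else 0) + 1)"
      by (simp add: add.commute)
    also have "\<dots> = (\<Sum>A\<in>Pow E. (\<Prod>e\<in>A. mpoly_var e * (if \<phi> (g e) = \<one>\<^bsub>integer_mod_group q\<^esub> then 1 else 0)) * (\<Prod>e\<in>E - A. 1))"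
      by (rule prod_add[OF assms(1)])
    also have "\<dots> = (\<Sum>A\<in>Pow E. (if \<forall>x\<in>g ` A. \<phi> x = 0 then Poly_Mapping.single (squarefree_monomial A) 1 else 0))"
    proof (intro sum.cong refl)
      fix A assume "A \<in> Pow E"
      then have "finite A" using assms(1) finite_subset by auto
      then show "(\<Prod>e\<in>A. mpoly_var e * (if \<phi> (g e) = \<one>\<^bsub>integer_mod_group q\<^esub> then 1 else 0)) * (\<Prod>e\<in>E - A. 1) =
          (if \<forall>x\<in>g ` A. \<phi> x = 0 then Poly_Mapping.single (squarefree_monomial A) 1 else 0)"
        by (simp only: prod prod.neutral_const mult_1_right)
    qed
    finally show "(\<Prod>e\<in>E. 1 + mpoly_var e * (if \<phi> (g e) = \<one>\<^bsub>integer_mod_group q\<^esub> then 1 else 0)) =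
       (\<Sum>A\<in>Pow E. (if \<forall>x\<in>g ` A. \<phi> x = 0 then Poly_Mapping.single (squarefree_monomial A) 1 else 0))" .
  qed
  also have "\<dots> = (\<Sum>A\<in>Pow E. \<Sum>\<phi>\<in>?H.
      (if \<forall>x\<in>g ` A. \<phi> x = 0 then Poly_Mapping.single (squarefree_monomial A) 1 else 0))"
    by (rule sum.swap)
  also have "\<dots> = (\<Sum>A\<in>Pow E. Poly_Mapping.single (squarefree_monomial A)
      (of_nat (card {\<phi> \<in> ?H. \<forall>x\<in>g ` A. \<phi> x = 0})))"
  proof (intro sum.cong refl)
    fix A :: "'e set"
    have single_of_nat: "of_nat k * Poly_Mapping.single (squarefree_monomial A) (1::rat) = Poly_Mapping.single (squarefree_monomial A) (of_nat k)" for k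
      by (simp add: mult_single flip: single_of_nat)
    have "(\<Sum>\<phi>\<in>?H. (if \<forall>x\<in>g ` A. \<phi> x = 0 then Poly_Mapping.single (squarefree_monomial A) (1::rat) else 0)) =
        of_nat (card {\<phi> \<in> ?H. \<forall>x\<in>g ` A. \<phi> x = 0}) * Poly_Mapping.single (squarefree_monomial A) 1"
      using assms(2) by (simp add: sum.If_cases Int_def)
    then show "(\<Sum>\<phi>\<in>?H. (if \<forall>x\<in>g ` A. \<phi> x = 0 then Poly_Mapping.single (squarefree_monomial A) (1::rat) else 0)) =
        Poly_Mapping.single (squarefree_monomial A) (of_nat (card {\<phi> \<in> ?H. \<forall>x\<in>g ` A. \<phi> x = 0}))"
      unfolding single_of_nat .
  qed
  finally show ?thesis .
qed

lemma mpoly_const_mult_Z_list: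
  assumes "finite E"
  shows "mpoly_const k * Z_list G E g q = (\<Sum>A\<in>Pow E. Poly_Mapping.single (squarefree_monomial A)
      (k * (of_nat (list_mult G g A) * q powi (- int (list_rank G g A)))))"
  unfolding Z_list_def arith_tutte_def sum_distrib_left
proof (intro sum.cong refl)
  fix A assume "A \<in> Pow E"
  then have "finite A" using assms finite_subset by auto
  then show "mpoly_const k * (mpoly_const (of_nat (list_mult G g A) * q powi (- int (list_rank G g A))) * (\<Prod>e\<in>A. mpoly_var e)) =
      Poly_Mapping.single (squarefree_monomial A) (k * (of_nat (list_mult G g A) * q powi (- int (list_rank G g A))))"
    by (simp add: prod_mpoly_var mpoly_const_def mult_single)
qed

text \<open>Coefficients are compared for each \<open>A\<close>. Additivity of the rank turns the
  rational coefficient on the right into a natural number, and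
  \<open>card_Hom_eq_torsion_iff\<close> for the quotient decides the equality.\<close>

lemma (in comm_group) Z_potts_eq_iff:
  assumes S: "finite S" "S \<subseteq> carrier G" "generate G S = carrier G"
    and E: "finite E" "h \<in> E \<rightarrow> carrier G" and q: "q > 0"
  shows "Z_potts G E h q = mpoly_const (of_nat q ^ abelian_rank G) * Z_list G E h (of_nat q) \<longleftrightarrow>
    (\<forall>A\<subseteq>E. \<forall>x\<in>torsion_elements (quot G h A). x [^]\<^bsub>quot G h A\<^esub> q = \<one>\<^bsub>quot G h A\<^esub>)"
proof -
  have "(of_nat (card {\<phi> \<in> Hom G (integer_mod_group q). \<forall>x\<in>h ` A. \<phi> x = 0}) :: rat) =
      of_nat q ^ abelian_rank G * (of_nat (list_mult G h A) * of_nat q powi (- int (list_rank G h A))) \<longleftrightarrow>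
    (\<forall>x\<in>torsion_elements (quot G h A). x [^]\<^bsub>quot G h A\<^esub> q = \<one>\<^bsub>quot G h A\<^esub>)" if A: "A \<subseteq> E" for A
  proof -
    have hA: "finite A" "h \<in> A \<rightarrow> carrier G" using A E finite_subset by auto
    have hA': "h ` A \<subseteq> carrier G" using hA by auto
    have sub: "subgroup (generate G (h ` A)) G" using hA' by (rule generate_is_subgroup)
    interpret Q: comm_group "quot G h A" unfolding quot_def using sub by (rule abelian_FactGroup)
    have rank: "abelian_rank G = list_rank G h A + abelian_rank (quot G h A)"
      unfolding list_rank_def quot_def by (rule abelian_rank_FactGroup[OF S hA])
    have "(of_nat q :: rat) ^ abelian_rank G * (of_nat (list_mult G h A) * of_nat q powi (- int (list_rank G h A)))
        = of_nat (q ^ abelian_rank (quot G h A) * card (torsion_elements (quot G h A)))"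
      unfolding rank list_mult_def using q by (simp add: power_add power_int_minus field_simps)
    then have "(of_nat (card {\<phi> \<in> Hom G (integer_mod_group q). \<forall>x\<in>h ` A. \<phi> x = 0}) :: rat) =
      of_nat q ^ abelian_rank G * (of_nat (list_mult G h A) * of_nat q powi (- int (list_rank G h A))) \<longleftrightarrow>
      card (Hom (quot G h A) (integer_mod_group q)) =
        q ^ abelian_rank (quot G h A) * card (torsion_elements (quot G h A))"
      unfolding card_Hom_vanishing[OF hA'] quot_def[symmetric] by (simp only: of_nat_eq_iff)
    also have "\<dots> \<longleftrightarrow> (\<forall>x\<in>torsion_elements (quot G h A). x [^]\<^bsub>quot G h A\<^esub> q = \<one>\<^bsub>quot G h A\<^esub>)"
      using FactGroup_generate[OF sub S(2,3)] S(1) unfolding quot_def[symmetric]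
      by (intro Q.card_Hom_eq_torsion_iff[OF _ _ _ q]) auto
    finally show ?thesis .
  qed
  then show ?thesis
    unfolding Z_potts_expansion[OF E(1) card_Hom_finitely_generated(1)[OF S q]]
      mpoly_const_mult_Z_list[OF E(1)] sum_squarefree_eq_iff[OF E(1)] by auto
qed

text \<open>The torsion elements form a subgroup, and an element raised to the order of its group is
  trivial. Were the subgroup infinite, \<open>card\<close> would be 0 and the power trivial as
  well.\<close>

lemma (in comm_group) torsion_pow_card:
  assumes x: "x \<in> torsion_elements G"
  shows "x [^] card (torsion_elements G) = \<one>"
proof -
  let ?T = "torsion_elements G"
  have sub: "subgroup ?T G"
  proof
    show "?T \<subseteq> carrier G" by (auto simp: torsion_elements_def)
    show "\<one> \<in> ?T" by (auto simp: torsion_elements_def)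
    show "inv y \<in> ?T" if "y \<in> ?T" for y
      using that by (auto simp: torsion_elements_def nat_pow_inv)
    show "y \<otimes> z \<in> ?T" if yz: "y \<in> ?T" "z \<in> ?T" for y z
    proof -
      obtain n m where nm: "y \<in> carrier G" "z \<in> carrier G" "n > (0::nat)" "m > (0::nat)" "y [^] n = \<one>" "z [^] m = \<one>"
        using yz by (auto simp: torsion_elements_def)
      have "(y \<otimes> z) [^] (n * m) = (y [^] n) [^] m \<otimes> (z [^] m) [^] n"
        using nm(1,2) by (simp add: nat_pow_distrib nat_pow_pow mult.commute)
      then have "(y \<otimes> z) [^] (n * m) = \<one>" using nm by simp
      moreover have "n * m > 0" using nm by simp
      ultimately show ?thesis using nm unfolding torsion_elements_def by blast
    qed
  qed
  interpret T: group "G\<lparr>carrier := ?T\<rparr>" using sub is_group by (rule subgroup.subgroup_is_group)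
  have "x [^]\<^bsub>G\<lparr>carrier := ?T\<rparr>\<^esub> order (G\<lparr>carrier := ?T\<rparr>) = \<one>\<^bsub>G\<lparr>carrier := ?T\<rparr>\<^esub>"
    by (rule T.pow_order_eq_1) (use x in simp)
  then show ?thesis by (simp add: order_def nat_pow_consistent[symmetric])
qed

theorem theorem7p7:
  fixes G :: "('a, 'b) monoid_scheme"
    and E :: "'e set"
    and g :: "'e \<Rightarrow> 'a"
    and q :: nat
  assumes "comm_group G"
    and "finitely_generated G"
    and "finite E"
    and "\<forall>e\<in>E. g e \<in> carrier G"
    and "q > 0"
  shows "(q \<in> Z_A G E g \<longleftrightarrow>
            Z_potts G E g q = mpoly_const (of_nat q ^ abelian_rank G) * Z_list G E g (of_nat q))
       \<and> (Lcm (list_mult G g ` list_bases G E g) dvd q \<longrightarrow>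
            Z_potts G E g q = mpoly_const (of_nat q ^ abelian_rank G) * Z_list G E g (of_nat q))"
proof -
  interpret comm_group G by fact
  obtain S where S: "finite S" "S \<subseteq> carrier G" "generate G S = carrier G"
    using assms(2) unfolding finitely_generated_def by blast
  have E: "finite E" "g \<in> E \<rightarrow> carrier G" using assms by auto
  have iff: "q \<in> Z_A G E g \<longleftrightarrow>
      Z_potts G E g q = mpoly_const (of_nat q ^ abelian_rank G) * Z_list G E g (of_nat q)"
    unfolding Z_potts_eq_iff[OF S E assms(5)] Z_A_iff[OF E] using assms(5) by blast
  \<comment> \<open>Each multiplicity m(B) divides \<open>q\<close>, and it is the order of the
    torsion group, which it therefore annihilates; the equivalence does the rest.\<close>
  moreover have "q \<in> Z_A G E g" if dvd: "Lcm (list_mult G g ` list_bases G E g) dvd q"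
    unfolding Z_A_def
  proof (intro CollectI conjI ballI)
    show "q > 0" by fact
    fix B x assume B: "B \<in> list_bases G E g" and x: "x \<in> torsion_elements (quot G g B)"
    have "B \<subseteq> E" using B by (simp add: list_bases_def matroid_bases_def)
    then have "subgroup (generate G (g ` B)) G" using E(2) by (intro generate_is_subgroup) auto
    then interpret Q: comm_group "quot G g B" unfolding quot_def by (rule abelian_FactGroup)
    have xQ: "x \<in> carrier (quot G g B)" using x by (simp add: torsion_elements_def)
    have "list_mult G g B dvd q" using dvd B by (meson dvd_Lcm dvd_trans imageI)
    then obtain k where "q = list_mult G g B * k" by (rule dvdE)
    then have "x [^]\<^bsub>quot G g B\<^esub> q = (x [^]\<^bsub>quot G g B\<^esub> list_mult G g B) [^]\<^bsub>quot G g B\<^esub> k"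
      using xQ by (simp add: Q.nat_pow_pow)
    then show "x [^]\<^bsub>quot G g B\<^esub> q = \<one>\<^bsub>quot G g B\<^esub>"
      using Q.torsion_pow_card[OF x] by (simp add: list_mult_def)
  qed
  ultimately show ?thesis by blast
qed

end
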